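(* Every randomized online algorithm for the online graph partitioning problem (with $\ell$ servers of capacity $k$, online capacity $(1+\varepsilon)k$ for a fixed constant $\varepsilon>0$) has competitive ratio $\Omega(\log\ell+\log k)$ against an oblivious adversary.
   Context: Online graph partitioning problem: There is a vertex set $V$ with $|V|=\ell\cdot k$. Initially each vertex is assigned to one of $\ell$ servers so that every server holds exactly $k$ vertices, and the graph $G=(V,E)$ has $E=\emptyset$. Edges of $G$ are then revealed one by one in an online fashion. The request sequence is guaranteed to be such that at all times there exists an assignment of vertices to servers in which each server holds at most $k$ vertices and every connected component of the current graph lies entirely on one server. After each edge insertion, an online algorithm must (possibly) move vertices between servers so that every connected component of the revealed graph lies entirely on a single server (cc-condition), while each server holds at most $(1+\varepsilon)k$ vertices. Each vertex move costs $1/k$. The optimal offline algorithm $\mathrm{OPT}$ knows the whole sequence in advance and must keep at most $k$ vertices per server; its cost is the minimum total cost of moves needed. For a randomized online algorithm, an oblivious adversary fixes the request sequence without knowing the algorithm's random choices, and the competitive ratio is the supremum over request sequences of $\mathbb{E}[\mathrm{cost}(\mathrm{ONL})]/\mathrm{cost}(\mathrm{OPT})$.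
   Formalization: Proved for k above a threshold and ℓ > 1+ε; for ε ≥ 1 also ℓ ≤ k^D is assumed for a fixed D, with the constant and threshold depending on ε and D, because for ε ≥ 1 some online algorithm has ratio at most k² for every ℓ, so a bound uniform in ℓ fails. *)

theory Defs
  imports "HOL-Probability.Probability"
begin

text \<open>Vertices and servers are natural numbers; the servers are \<open>{..<l}\<close>.  An edge is a
  two-element set of vertices.\<close>

definition same_component :: "nat set set \<Rightarrow> nat \<Rightarrow> nat \<Rightarrow> bool" where
  "same_component E u v \<longleftrightarrow> (u, v) \<in> {(x, y). {x, y} \<in> E}\<^sup>*"

definition initial_assignment :: "nat \<Rightarrow> nat \<Rightarrow> nat set \<Rightarrow> (nat \<Rightarrow> nat) \<Rightarrow> bool" where
  "initial_assignment l k V a0 \<longleftrightarrow>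
     finite V \<and> card V = l * k \<and> a0 ` V \<subseteq> {..<l} \<and> (\<forall>s<l. card {v \<in> V. a0 v = s} = k)"

definition feasible :: "nat \<Rightarrow> real \<Rightarrow> nat set \<Rightarrow> nat set set \<Rightarrow> (nat \<Rightarrow> nat) \<Rightarrow> bool" where
  "feasible l cap V E a \<longleftrightarrow>
     a ` V \<subseteq> {..<l} \<and>
     (\<forall>s<l. real (card {v \<in> V. a v = s}) \<le> cap) \<and>
     (\<forall>u\<in>V. \<forall>v\<in>V. same_component E u v \<longrightarrow> a u = a v)"

definition request_sequences :: "nat \<Rightarrow> nat \<Rightarrow> nat set \<Rightarrow> nat set list set" where
  "request_sequences l k V =
     {\<sigma>. distinct \<sigma> \<and> set \<sigma> \<subseteq> {{u, v} | u v. u \<in> V \<and> v \<in> V \<and> u \<noteq> v} \<and>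
         (\<forall>t\<le>length \<sigma>. \<exists>a. feasible l (real k) V (set (take t \<sigma>)) a)}"

text \<open>A schedule \<open>B\<close> gives the assignment \<open>B t\<close> in force after the first \<open>t\<close> requests have
  been served.\<close>

definition schedule ::
  "nat \<Rightarrow> real \<Rightarrow> nat set \<Rightarrow> (nat \<Rightarrow> nat) \<Rightarrow> nat set list \<Rightarrow> (nat \<Rightarrow> nat \<Rightarrow> nat) \<Rightarrow> bool" where
  "schedule l cap V a0 \<sigma> B \<longleftrightarrow>
     (\<forall>v\<in>V. B 0 v = a0 v) \<and> (\<forall>t\<le>length \<sigma>. feasible l cap V (set (take t \<sigma>)) (B t))"

definition schedule_cost :: "nat \<Rightarrow> nat set \<Rightarrow> nat set list \<Rightarrow> (nat \<Rightarrow> nat \<Rightarrow> nat) \<Rightarrow> real" where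
  "schedule_cost k V \<sigma> B =
     (\<Sum>t<length \<sigma>. real (card {v \<in> V. B t v \<noteq> B (Suc t) v}) / real k)"

definition opt_cost :: "nat \<Rightarrow> nat \<Rightarrow> nat set \<Rightarrow> (nat \<Rightarrow> nat) \<Rightarrow> nat set list \<Rightarrow> real" where
  "opt_cost l k V a0 \<sigma> = Inf {schedule_cost k V \<sigma> B | B. schedule l (real k) V a0 \<sigma> B}"

text \<open>A deterministic online algorithm maps every finite sequence of revealed edges to the
  assignment it uses after the last of them; this is what makes it online.\<close>

type_synonym det_algorithm = "nat set list \<Rightarrow> nat \<Rightarrow> nat"

definition run :: "det_algorithm \<Rightarrow> nat set list \<Rightarrow> nat \<Rightarrow> nat \<Rightarrow> nat" where
  "run A \<sigma> = (\<lambda>t. A (take t \<sigma>))"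

definition online_algorithm ::
  "nat \<Rightarrow> nat \<Rightarrow> real \<Rightarrow> nat set \<Rightarrow> (nat \<Rightarrow> nat) \<Rightarrow> det_algorithm \<Rightarrow> bool" where
  "online_algorithm l k \<epsilon> V a0 A \<longleftrightarrow>
     (\<forall>\<sigma>\<in>request_sequences l k V. schedule l ((1 + \<epsilon>) * real k) V a0 \<sigma> (run A \<sigma>))"

text \<open>A randomized online algorithm is a probability distribution on deterministic ones.\<close>

definition randomized_online_algorithm ::
  "nat \<Rightarrow> nat \<Rightarrow> real \<Rightarrow> nat set \<Rightarrow> (nat \<Rightarrow> nat) \<Rightarrow> det_algorithm measure \<Rightarrow> bool" where
  "randomized_online_algorithm l k \<epsilon> V a0 M \<longleftrightarrow>
     prob_space M \<and>
     (\<forall>\<sigma>\<in>request_sequences l k V. \<forall>v\<in>V. (\<lambda>A. A \<sigma> v) \<in> measurable M (count_space UNIV)) \<and>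
     (AE A in M. online_algorithm l k \<epsilon> V a0 A)"

definition expected_cost :: "nat \<Rightarrow> nat set \<Rightarrow> det_algorithm measure \<Rightarrow> nat set list \<Rightarrow> ennreal" where
  "expected_cost k V M \<sigma> = (\<integral>\<^sup>+ A. ennreal (schedule_cost k V \<sigma> (run A \<sigma>)) \<partial>M)"

text \<open>In \<open>ennreal\<close>, \<open>x / 0\<close> is \<open>\<infinity>\<close> for \<open>x > 0\<close>, and \<open>0 / 0 = 0\<close>.  The supremum ranges over
  fixed sequences, chosen independently of the random choice of \<open>A\<close>: the adversary is
  oblivious.\<close>

definition competitive_ratio ::
  "nat \<Rightarrow> nat \<Rightarrow> nat set \<Rightarrow> (nat \<Rightarrow> nat) \<Rightarrow> det_algorithm measure \<Rightarrow> ennreal" where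
  "competitive_ratio l k V a0 M =
     (SUP \<sigma>\<in>request_sequences l k V. expected_cost k V M \<sigma> / ennreal (opt_cost l k V a0 \<sigma>))"

text \<open>On the range of parameters in a lower bound \<open>c * (ln l + ln k)\<close> for this ratio.  If
  \<open>l \<le> 1 + \<epsilon>\<close>, one server may hold all vertices.  If \<open>\<epsilon> \<ge> 1\<close>, some server always has room for any
  component (its load is at most \<open>k\<close> by averaging), so the algorithm that puts two components
  merged across servers on such a server has ratio at most \<open>k\<^sup>2\<close> for every \<open>l\<close>; hence for
  \<open>\<epsilon> \<ge> 1\<close> the bound cannot hold uniformly in \<open>l\<close> and needs \<open>l\<close> to be bounded in terms of \<open>k\<close>.\<close>

end

theory Submission
  imports Defs
begin

text \<open>Everything the adversary reveals is the set of all edges inside the classes of a partition,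
  so a phase is determined by a coarsening, and an adversary knowing the distribution of the
  algorithm picks the coarsening that is most expensive on average.

  For \<open>ln k\<close>, there are about \<open>log\<^sub>4 k\<close> rounds, each merging components of equal size in pairs. The
  pairs come from a cyclic shift between one half of the components and the other; averaged over
  the shifts, a constant fraction of the pairs is split between servers, because no server holds
  almost all vertices. Each round thus costs \<open>\<Omega>(l)\<close>, while moving all vertices once costs only \<open>l\<close>.

  For \<open>ln l\<close> (needed only if \<open>\<epsilon> < 1\<close> and \<open>k \<le> l\<close>), the adversary first joins a set \<open>T\<close> of one vertex
  from each of \<open>k\<close> servers. Then it joins the remaining vertices of the servers, one server after
  the other, in an order chosen by averaging. As \<open>T\<close> and the \<open>l\<close> groups cannot all be almost gathered on
  different servers, with \<open>r\<close> groups left a step costs \<open>\<Omega>(1 / r)\<close> on average. The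
  optimum spreads the one group that is never joined and puts \<open>T\<close> in its place, at cost at most 2.\<close>

section \<open>Adversaries revealing partitions\<close>

text \<open>Whole cliques rather than spanning trees, so that coarsening a partition only adds edges
  and a revealed sequence can be continued to any coarser partition.\<close>

definition clique_edges :: "nat set \<Rightarrow> (nat \<Rightarrow> nat) \<Rightarrow> nat set set" where
  "clique_edges V g = {{u, v} | u v. u \<in> V \<and> v \<in> V \<and> u \<noteq> v \<and> g u = g v}"

definition reveals :: "nat set \<Rightarrow> (nat \<Rightarrow> nat) \<Rightarrow> nat set list \<Rightarrow> bool" where
  "reveals V g \<sigma> \<longleftrightarrow> distinct \<sigma> \<and> set \<sigma> = clique_edges V g"

text \<open>Partitions are given by labelings, of which only the equality pattern matters. As an
  assignment is itself a labeling by servers, the same relation also expresses the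
  cc-condition.\<close>

definition coarsens :: "nat set \<Rightarrow> (nat \<Rightarrow> nat) \<Rightarrow> (nat \<Rightarrow> nat) \<Rightarrow> bool" where
  "coarsens V g h \<longleftrightarrow> (\<forall>u\<in>V. \<forall>v\<in>V. g u = g v \<longrightarrow> h u = h v)"

definition packing :: "nat \<Rightarrow> real \<Rightarrow> nat set \<Rightarrow> (nat \<Rightarrow> nat) \<Rightarrow> (nat \<Rightarrow> nat) \<Rightarrow> bool" where
  "packing l cap V g a \<longleftrightarrow>
     a ` V \<subseteq> {..<l} \<and> (\<forall>s<l. real (card {v \<in> V. a v = s}) \<le> cap) \<and> coarsens V g a"

definition moved :: "nat set \<Rightarrow> (nat \<Rightarrow> nat) \<Rightarrow> (nat \<Rightarrow> nat) \<Rightarrow> nat" where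
  "moved V a b = card {v \<in> V. a v \<noteq> b v}"

lemma finite_clique_edges:
  assumes "finite V" shows "finite (clique_edges V g)"
  by (rule finite_subset[of _ "Pow V"]) (use assms in \<open>auto simp: clique_edges_def\<close>)

lemma clique_edges_mono:
  assumes "coarsens V g h" shows "clique_edges V g \<subseteq> clique_edges V h"
  using assms unfolding clique_edges_def coarsens_def by blast

lemma same_component_imp_same_label:
  assumes "E \<subseteq> clique_edges V g" "same_component E u v"
  shows "g u = g v"
proof -
  have edge: "g x = g y" if "{x, y} \<in> E" for x y
    using subsetD[OF assms(1) that] by (auto simp: clique_edges_def doubleton_eq_iff)
  from assms(2) have "(u, v) \<in> {(x, y). {x, y} \<in> E}\<^sup>*"
    by (simp add: same_component_def)
  then show ?thesis by (induction rule: rtrancl_induct) (auto dest: edge)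
qed

lemma same_component_clique_edges:
  assumes "u \<in> V" "v \<in> V" "g u = g v"
  shows "same_component (clique_edges V g) u v"
proof (cases "u = v")
  case False
  then have "{u, v} \<in> clique_edges V g" using assms by (auto simp: clique_edges_def)
  then show ?thesis by (auto simp: same_component_def)
qed (simp add: same_component_def)

lemma packing_imp_feasible:
  assumes "E \<subseteq> clique_edges V g" "packing l cap V g a"
  shows "feasible l cap V E a"
  using assms same_component_imp_same_label[OF assms(1)]
  unfolding packing_def feasible_def coarsens_def by blast

lemma feasible_imp_packing:
  assumes "feasible l cap V (clique_edges V g) a"
  shows "packing l cap V g a"
  using assms same_component_clique_edges[of _ V _ g]
  unfolding packing_def feasible_def coarsens_def by blast

text \<open>A prefix reveals fewer edges, so one packing of the final partition is a witness for all
  times.\<close>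

lemma reveals_request_sequence:
  assumes "reveals V g \<sigma>" "packing l (real k) V g a"
  shows "\<sigma> \<in> request_sequences l k V"
proof -
  have "feasible l (real k) V (set (take t \<sigma>)) a" for t
    using assms packing_imp_feasible[of "set (take t \<sigma>)" V g] set_take_subset[of t \<sigma>]
    by (auto simp: reveals_def)
  moreover have "set \<sigma> \<subseteq> {{u, v} | u v. u \<in> V \<and> v \<in> V \<and> u \<noteq> v}"
    using assms(1) unfolding reveals_def clique_edges_def by blast
  ultimately show ?thesis using assms(1) by (auto simp: request_sequences_def reveals_def)
qed

lemma request_sequences_take:
  assumes "\<sigma> \<in> request_sequences l k V"
  shows "take t \<sigma> \<in> request_sequences l k V"
  using assms set_take_subset[of t \<sigma>] by (auto simp: request_sequences_def min_def)

lemma packing_coarsens: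
  assumes "packing l cap V h a" "coarsens V g h"
  shows "packing l cap V g a"
  using assms unfolding packing_def coarsens_def by blast

lemma reveals_extend:
  assumes "finite V" "reveals V g \<sigma>" "coarsens V g h"
  obtains \<rho> where "reveals V h (\<sigma> @ \<rho>)"
proof -
  obtain \<rho> where "set \<rho> = clique_edges V h - clique_edges V g" "distinct \<rho>"
    using finite_distinct_list[of "clique_edges V h - clique_edges V g"]
      finite_clique_edges[OF assms(1)] by blast
  then have "reveals V h (\<sigma> @ \<rho>)"
    using assms(2) clique_edges_mono[OF assms(3)] by (auto simp: reveals_def)
  then show ?thesis by (rule that)
qed

section \<open>Costs of online runs and of the optimum\<close>

lemma moved_triangle:
  assumes "finite V"
  shows "moved V a c \<le> moved V a b + moved V b c"
proof -
  have "moved V a c \<le> card ({v \<in> V. a v \<noteq> b v} \<union> {v \<in> V. b v \<noteq> c v})"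
    unfolding moved_def by (rule card_mono) (use assms in auto)
  also have "\<dots> \<le> moved V a b + moved V b c"
    unfolding moved_def by (rule card_Un_le)
  finally show ?thesis .
qed

lemma moved_le_sum:
  assumes "finite V" "m \<le> n"
  shows "moved V (B m) (B n) \<le> (\<Sum>t\<in>{m..<n}. moved V (B t) (B (Suc t)))"
  using assms(2)
proof (induction n rule: dec_induct)
  case base
  then show ?case by (simp add: moved_def)
next
  case (step n)
  then show ?case using moved_triangle[OF assms(1), of "B m" "B (Suc n)" "B n"] by simp
qed

text \<open>Being online, \<open>A\<close> acts on \<open>\<sigma> @ \<rho>\<close> as on \<sigma>
  until \<sigma> ends. From then on the triangle inequality for \<open>moved\<close> bounds the cost
  from below by the net displacement.\<close>

lemma schedule_cost_append:
  assumes "finite V"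
  shows "schedule_cost k V \<sigma> (run A \<sigma>) + real (moved V (A \<sigma>) (A (\<sigma> @ \<rho>))) / real k
           \<le> schedule_cost k V (\<sigma> @ \<rho>) (run A (\<sigma> @ \<rho>))"
proof -
  let ?n = "length \<sigma>" and ?N = "length (\<sigma> @ \<rho>)" and ?B = "run A (\<sigma> @ \<rho>)"
  have "moved V (?B ?n) (?B ?N) \<le> (\<Sum>t\<in>{?n..<?N}. moved V (?B t) (?B (Suc t)))"
    by (rule moved_le_sum) (use assms in auto)
  then have "real (moved V (A \<sigma>) (A (\<sigma> @ \<rho>))) / real k
      \<le> real (\<Sum>t\<in>{?n..<?N}. moved V (?B t) (?B (Suc t))) / real k"
    by (intro divide_right_mono of_nat_mono) (simp_all add: run_def)
  also have "\<dots> = (\<Sum>t\<in>{?n..<?N}. real (card {v \<in> V. ?B t v \<noteq> ?B (Suc t) v}) / real k)"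
    by (simp add: moved_def sum_divide_distrib)
  finally have 1: "real (moved V (A \<sigma>) (A (\<sigma> @ \<rho>))) / real k \<le> \<dots>" .
  have "schedule_cost k V \<sigma> (run A \<sigma>)
      = (\<Sum>t<?n. real (card {v \<in> V. ?B t v \<noteq> ?B (Suc t) v}) / real k)"
    unfolding schedule_cost_def by (intro sum.cong) (auto simp: run_def)
  moreover have "schedule_cost k V (\<sigma> @ \<rho>) ?B
      = (\<Sum>t<?n. real (card {v \<in> V. ?B t v \<noteq> ?B (Suc t) v}) / real k)
        + (\<Sum>t\<in>{?n..<?N}. real (card {v \<in> V. ?B t v \<noteq> ?B (Suc t) v}) / real k)"
    unfolding schedule_cost_def lessThan_atLeast0
    by (rule sum.atLeastLessThan_concat[symmetric]) auto
  ultimately show ?thesis using 1 by linarith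
qed

text \<open>One possible offline schedule switches to the final packing at the first request and
  stays there.\<close>

lemma opt_cost_le:
  assumes init: "initial_assignment l k V a0" and rev: "reveals V g \<sigma>"
    and a: "packing l (real k) V g a"
  shows "opt_cost l k V a0 \<sigma> \<le> real (moved V a0 a) / real k"
proof -
  define B where "B = (\<lambda>t::nat. if t = 0 then a0 else a)"
  have "feasible l (real k) V (set (take t \<sigma>)) (B t)" for t
  proof (cases "t = 0")
    case True
    then show ?thesis
      using init by (auto simp: B_def feasible_def initial_assignment_def same_component_def)
  next
    case False
    moreover have "set (take t \<sigma>) \<subseteq> clique_edges V g"
      using rev set_take_subset[of t \<sigma>] by (auto simp: reveals_def)
    ultimately show ?thesis using packing_imp_feasible[OF _ a] by (simp add: B_def)
  qed
  then have "schedule l (real k) V a0 \<sigma> B" by (simp add: schedule_def B_def)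
  then have "opt_cost l k V a0 \<sigma> \<le> schedule_cost k V \<sigma> B"
    unfolding opt_cost_def
    by (intro cInf_lower bdd_belowI[of _ 0]) (auto simp: schedule_cost_def intro!: sum_nonneg)
  also have "\<dots> = (\<Sum>t<length \<sigma>. if t = 0 then real (moved V a0 a) / real k else 0)"
    unfolding schedule_cost_def by (intro sum.cong) (auto simp: B_def moved_def)
  \<comment> \<open>Only an inequality, because an empty \<sigma> costs 0.\<close>
  also have "\<dots> \<le> real (moved V a0 a) / real k" by (simp add: sum.delta)
  finally show ?thesis .
qed

section \<open>Expectation over the random choices\<close>

lemma moved_measurable:
  assumes R: "randomized_online_algorithm l k \<epsilon> V a0 M" and "finite V"
    and \<sigma>: "\<sigma> \<in> request_sequences l k V" and \<tau>: "\<tau> \<in> request_sequences l k V"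
  shows "(\<lambda>A. real (moved V (A \<sigma>) (A \<tau>))) \<in> borel_measurable M"
proof -
  \<comment> \<open>Measurability is given vertex by vertex only, so \<open>moved\<close> is written
    as a finite sum of indicators.\<close>
  have "(\<lambda>A. if A \<sigma> v \<noteq> A \<tau> v then 1 else 0 :: real) \<in> borel_measurable M" if "v \<in> V" for v
  proof -
    have [measurable]: "(\<lambda>A. A \<sigma> v) \<in> measurable M (count_space UNIV)"
      "(\<lambda>A. A \<tau> v) \<in> measurable M (count_space UNIV)"
      using R \<sigma> \<tau> that by (auto simp: randomized_online_algorithm_def)
    show ?thesis by measurable
  qed
  then have "(\<lambda>A. \<Sum>v\<in>V. if A \<sigma> v \<noteq> A \<tau> v then 1 else 0 :: real) \<in> borel_measurable M"
    by (rule borel_measurable_sum)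
  moreover have "(\<Sum>v\<in>V. if A \<sigma> v \<noteq> A \<tau> v then 1 else 0 :: real) = real (moved V (A \<sigma>) (A \<tau>))" for A
    using \<open>finite V\<close> by (simp add: moved_def sum.If_cases Int_def conj_commute)
  ultimately show ?thesis by simp
qed

lemma schedule_cost_measurable:
  assumes R: "randomized_online_algorithm l k \<epsilon> V a0 M" and "finite V"
    and \<sigma>: "\<sigma> \<in> request_sequences l k V"
  shows "(\<lambda>A. schedule_cost k V \<sigma> (run A \<sigma>)) \<in> borel_measurable M"
  unfolding schedule_cost_def run_def moved_def[symmetric]
  by (intro borel_measurable_sum borel_measurable_divide borel_measurable_const
        moved_measurable[OF R \<open>finite V\<close>] request_sequences_take[OF \<sigma>])

lemma online_packing:
  assumes "online_algorithm l k \<epsilon> V a0 A" "\<sigma> \<in> request_sequences l k V" "reveals V g \<sigma>"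
  shows "packing l ((1 + \<epsilon>) * real k) V g (A \<sigma>)"
proof -
  have "feasible l ((1 + \<epsilon>) * real k) V (set (take (length \<sigma>) \<sigma>)) (run A \<sigma> (length \<sigma>))"
    using assms(1,2) unfolding online_algorithm_def schedule_def by blast
  then show ?thesis using assms(3) by (intro feasible_imp_packing) (simp add: run_def reveals_def)
qed

text \<open>Yao's principle, one phase at a time: a cost that every deterministic algorithm pays in
  total over the alternatives \<open>J\<close> is paid in expectation, up to the factor \<open>1 / card J\<close>, on
  one of them.\<close>

lemma adversary_step:
  assumes init: "initial_assignment l k V a0" and R: "randomized_online_algorithm l k \<epsilon> V a0 M"
    and rev: "reveals V g \<sigma>" and J: "finite J" "J \<noteq> {}"
    and coarse: "\<And>j. j \<in> J \<Longrightarrow> coarsens V g (h j)"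
    and pack: "\<And>j. j \<in> J \<Longrightarrow> \<exists>a. packing l (real k) V (h j) a"
    and X: "0 \<le> X"
    and cost: "\<And>a b. packing l ((1 + \<epsilon>) * real k) V g a \<Longrightarrow>
       (\<And>j. j \<in> J \<Longrightarrow> packing l ((1 + \<epsilon>) * real k) V (h j) (b j)) \<Longrightarrow>
       X \<le> (\<Sum>j\<in>J. real (moved V a (b j)))"
  shows "\<exists>j\<in>J. \<exists>\<tau>. reveals V (h j) \<tau> \<and>
           expected_cost k V M \<sigma> + ennreal (X / (real (card J) * real k)) \<le> expected_cost k V M \<tau>"
proof -
  have fin: "finite V" using init by (simp add: initial_assignment_def)
  interpret prob_space M using R by (simp add: randomized_online_algorithm_def)
  have "\<exists>\<rho>. reveals V (h j) (\<sigma> @ \<rho>)" if "j \<in> J" for j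
    using reveals_extend[OF fin rev coarse[OF that]] by blast
  \<comment> \<open>Each continuation depends on \<open>j\<close> alone and not on \<open>A\<close>,
    so the adversary remains oblivious.\<close>
  then obtain \<rho> where \<rho>: "\<And>j. j \<in> J \<Longrightarrow> reveals V (h j) (\<sigma> @ \<rho> j)" by metis
  have req: "\<sigma> @ \<rho> j \<in> request_sequences l k V" if "j \<in> J" for j
    using pack[OF that] reveals_request_sequence[OF \<rho>[OF that]] by blast
  have req\<sigma>: "\<sigma> \<in> request_sequences l k V"
    using J(2) pack coarse packing_coarsens reveals_request_sequence[OF rev] by blast
  define F where "F j = (\<integral>\<^sup>+ A. ennreal (real (moved V (A \<sigma>) (A (\<sigma> @ \<rho> j))) / real k) \<partial>M)" for j
  have meas: "(\<lambda>A. ennreal (real (moved V (A \<sigma>) (A (\<sigma> @ \<rho> j))) / real k)) \<in> borel_measurable M"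
    if "j \<in> J" for j
    using moved_measurable[OF R fin req\<sigma> req[OF that]] by measurable
  have "ennreal (X / real k) = (\<integral>\<^sup>+ A. ennreal (X / real k) \<partial>M)"
    by (simp add: emeasure_space_1)
  also have "\<dots> \<le> (\<integral>\<^sup>+ A. (\<Sum>j\<in>J. ennreal (real (moved V (A \<sigma>) (A (\<sigma> @ \<rho> j))) / real k)) \<partial>M)"
  proof (rule nn_integral_mono_AE)
    have "AE A in M. online_algorithm l k \<epsilon> V a0 A"
      using R by (simp add: randomized_online_algorithm_def)
    then show "AE A in M. ennreal (X / real k)
        \<le> (\<Sum>j\<in>J. ennreal (real (moved V (A \<sigma>) (A (\<sigma> @ \<rho> j))) / real k))"
    proof eventually_elim
      case (elim A)
      have "X \<le> (\<Sum>j\<in>J. real (moved V (A \<sigma>) (A (\<sigma> @ \<rho> j))))"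
        using online_packing[OF elim req\<sigma> rev] online_packing[OF elim req \<rho>] by (intro cost) auto
      then have "X / real k \<le> (\<Sum>j\<in>J. real (moved V (A \<sigma>) (A (\<sigma> @ \<rho> j))) / real k)"
        by (simp add: divide_right_mono flip: sum_divide_distrib)
      then show ?case by (subst sum_ennreal) (auto intro!: ennreal_leI)
    qed
  qed
  also have "\<dots> = (\<Sum>j\<in>J. F j)"
    unfolding F_def by (rule nn_integral_sum) (rule meas)
  finally have sum: "ennreal (X / real k) \<le> (\<Sum>j\<in>J. F j)" .
  \<comment> \<open>The alternative with the largest expected cost costs at least the
    average.\<close>
  have "Max (F ` J) \<in> F ` J" using J by (intro Max_in) auto
  then obtain j where j: "j \<in> J" "F j = Max (F ` J)" by (metis imageE)
  then have "(\<Sum>j\<in>J. F j) \<le> of_nat (card J) * F j"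
    using J(1) by (intro sum_bounded_above) auto
  with sum have *: "ennreal (X / real k) \<le> ennreal (real (card J)) * F j"
    by (simp add: ennreal_of_nat_eq_real_of_nat)
  have pos: "0 < card J" using J by (simp add: card_gt_0_iff)
  have "ennreal (X / (real (card J) * real k)) = ennreal (1 / real (card J)) * ennreal (X / real k)"
    by (subst ennreal_mult'[symmetric]) auto
  also have "\<dots> \<le> ennreal (1 / real (card J)) * (ennreal (real (card J)) * F j)"
    by (intro mult_left_mono *) auto
  also have "\<dots> = F j"
    unfolding mult.assoc[symmetric] using pos by (subst ennreal_mult'[symmetric]) auto
  finally have gain: "ennreal (X / (real (card J) * real k)) \<le> F j" .
  have nonneg: "0 \<le> schedule_cost k V \<tau> B" for \<tau> B
    by (auto simp: schedule_cost_def intro!: sum_nonneg)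
  have "expected_cost k V M \<sigma> + F j = (\<integral>\<^sup>+ A. ennreal (schedule_cost k V \<sigma> (run A \<sigma>))
      + ennreal (real (moved V (A \<sigma>) (A (\<sigma> @ \<rho> j))) / real k) \<partial>M)"
    unfolding expected_cost_def F_def
    by (rule nn_integral_add[symmetric])
       (use schedule_cost_measurable[OF R fin req\<sigma>] meas[OF j(1)] in auto)
  also have "\<dots> \<le> expected_cost k V M (\<sigma> @ \<rho> j)"
    unfolding expected_cost_def
    by (intro nn_integral_mono)
       (auto simp flip: ennreal_plus simp: nonneg intro!: ennreal_leI schedule_cost_append[OF fin])
  finally have "expected_cost k V M \<sigma> + F j \<le> expected_cost k V M (\<sigma> @ \<rho> j)" .
  moreover have "expected_cost k V M \<sigma> + ennreal (X / (real (card J) * real k))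
      \<le> expected_cost k V M \<sigma> + F j"
    using gain by (rule add_left_mono)
  ultimately show ?thesis using j(1) \<rho> by (meson order_trans)
qed

text \<open>Both lower bounds end here. \<open>Q\<close> bounds the cost of moving straight to a
  final packing: 2 in the bound by servers, \<open>l\<close> in the bound by capacity.\<close>

lemma competitive_ratio_ge:
  assumes init: "initial_assignment l k V a0" and rev: "reveals V g \<sigma>"
    and a: "packing l (real k) V g a"
    and opt: "real (moved V a0 a) / real k \<le> Q" and "0 < Q"
    and onl: "ennreal (c * Q) \<le> expected_cost k V M \<sigma>"
  shows "ennreal c \<le> competitive_ratio l k V a0 M"
proof (cases "c \<le> 0")
  case True
  then show ?thesis by (simp add: ennreal_neg)
next
  case False
  let ?opt = "opt_cost l k V a0 \<sigma>"
  have "ennreal c \<le> ennreal (c * Q) / ennreal ?opt"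
  \<comment> \<open>An optimum of cost 0 makes the quotient infinite, because \<open>c * Q\<close>
    is positive.\<close>
  proof (cases "?opt \<le> 0")
    case True
    then show ?thesis using \<open>0 < Q\<close> False by (simp add: ennreal_neg)
  next
    case pos: False
    have "c * ?opt \<le> c * Q"
      using opt opt_cost_le[OF init rev a] False by (intro mult_left_mono) auto
    then have "c \<le> c * Q / ?opt" using pos by (simp add: field_simps)
    then show ?thesis using pos False \<open>0 < Q\<close> by (subst divide_ennreal) (auto intro: ennreal_leI)
  qed
  also have "\<dots> \<le> expected_cost k V M \<sigma> / ennreal ?opt"
    using onl by (rule divide_right_mono_ennreal)
  also have "\<dots> \<le> competitive_ratio l k V a0 M"
    unfolding competitive_ratio_def
    by (intro SUP_upper reveals_request_sequence[OF rev a])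
  finally show ?thesis .
qed

section \<open>Lower bound in the number of servers\<close>

text \<open>The classes are \<open>T\<close>, the rest of each joined group, and singletons; labels
  equal to, below and above \<open>l\<close> keep the three kinds apart.\<close>

definition kill_label :: "nat \<Rightarrow> (nat \<Rightarrow> nat) \<Rightarrow> nat set \<Rightarrow> nat set \<Rightarrow> nat \<Rightarrow> nat" where
  "kill_label l a0 T R v = (if v \<in> T then l else if a0 v \<in> R then a0 v else Suc (l + v))"

lemma kill_label_eq_iff:
  assumes "a0 u < l" "a0 v < l"
  shows "kill_label l a0 T R u = kill_label l a0 T R v \<longleftrightarrow>
    u = v \<or> (u \<in> T \<and> v \<in> T) \<or> (u \<notin> T \<and> v \<notin> T \<and> a0 u \<in> R \<and> a0 u = a0 v)"
  using assms by (auto simp: kill_label_def)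

text \<open>The size is written as the number of servers other than \<open>t\<close> that give a
  vertex to \<open>T\<close>, because these are the places over which group \<open>t\<close> will be
  spread.\<close>

lemma card_group_minus_transversal:
  assumes init: "initial_assignment l k V a0" and T: "T \<subseteq> V" "bij_betw a0 T {..<k}" and "t < l"
  shows "card {v \<in> V - T. a0 v = t} = card ({..<k} - {t})"
proof -
  have fin: "finite V" using init by (simp add: initial_assignment_def)
  have eq: "{v \<in> V - T. a0 v = t} = {v \<in> V. a0 v = t} - {v \<in> T. a0 v = t}" by auto
  have "card {v \<in> T. a0 v = t} = (if t < k then 1 else 0)"
  proof (cases "t < k")
    case True
    then obtain w where "w \<in> T" "a0 w = t"
      using T(2) by (metis bij_betw_def imageE lessThan_iff)
    then have "{v \<in> T. a0 v = t} = {w}" using T(2) by (auto simp: bij_betw_def inj_on_def)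
    then show ?thesis using True by simp
  next
    case False
    then have "{v \<in> T. a0 v = t} = {}" using T(2) by (auto simp: bij_betw_def)
    then show ?thesis using False by (metis card.empty)
  qed
  moreover have "card {v \<in> V. a0 v = t} = k" using init \<open>t < l\<close> by (simp add: initial_assignment_def)
  moreover have "finite {v \<in> T. a0 v = t}" using fin T(1) by (auto intro: finite_subset)
  ultimately show ?thesis
    unfolding eq using T(1) by (subst card_Diff_subset) auto
qed

text \<open>Server \<open>s\<close>, whose group was not joined, is emptied to make room for
  \<open>T\<close>; its other vertices fill, one each, the gaps that \<open>T\<close> leaves on the
  other servers. Only \<open>T\<close> and the group of \<open>s\<close> move, and both have
  \<open>k\<close> vertices.\<close>

lemma kill_label_packing:
  assumes init: "initial_assignment l k V a0" and T: "T \<subseteq> V" "bij_betw a0 T {..<k}"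
    and "k \<le> l" "R \<subseteq> {..<l}" "s < l" "s \<notin> R"
  shows "\<exists>a. packing l (real k) V (kill_label l a0 T R) a \<and> moved V a0 a \<le> 2 * k"
proof -
  have fin: "finite V" "finite T" and a0: "\<And>v. v \<in> V \<Longrightarrow> a0 v < l"
    using init finite_subset[OF T(1)] by (auto simp: initial_assignment_def)
  have cT: "card T = k" using bij_betw_same_card[OF T(2)] by simp
  define U where "U t = {v \<in> V - T. a0 v = t}" for t
  have finU: "finite (U t)" for t using fin by (simp add: U_def)
  have cU: "card (U t) = card ({..<k} - {t})" if "t < l" for t
    using card_group_minus_transversal[OF init T that] by (simp add: U_def)
  then obtain \<phi> where \<phi>: "bij_betw \<phi> (U s) ({..<k} - {s})"
    using finite_same_card_bij[of "U s" "{..<k} - {s}"] finU \<open>s < l\<close> by blast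
  have \<phi>': "\<phi> v < k" "\<phi> v \<noteq> s" if "v \<in> V" "v \<notin> T" "a0 v = s" for v
    using bij_betwE[OF \<phi>] that by (auto simp: U_def)
  define a where "a v = (if v \<in> T then s else if a0 v = s then \<phi> v else a0 v)" for v
  have range: "a ` V \<subseteq> {..<l}"
    using a0 \<phi>'(1) \<open>s < l\<close> \<open>k \<le> l\<close> by (force simp: a_def)
  have load: "card {v \<in> V. a v = t} \<le> k" if "t < l" for t
  proof (cases "t = s")
    case True
    have "{v \<in> V. a v = s} = T" using T(1) \<phi>'(2) by (auto simp: a_def split: if_splits)
    then show ?thesis using True cT by simp
  next
    case False
    \<comment> \<open>A server \<open>t < k\<close> keeps \<open>k - 1\<close> vertices of its own
      and receives at most one through \<phi>; a server \<open>t \<ge> k\<close> keeps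
      \<open>k\<close> and receives none.\<close>
    have "{v \<in> V. a v = t} \<subseteq> U t \<union> {v \<in> U s. \<phi> v = t}"
      using False by (auto simp: a_def U_def split: if_splits)
    then have "card {v \<in> V. a v = t} \<le> card (U t \<union> {v \<in> U s. \<phi> v = t})"
      using finU by (intro card_mono) auto
    also have "\<dots> \<le> card (U t) + card {v \<in> U s. \<phi> v = t}" by (rule card_Un_le)
    also have "card {v \<in> U s. \<phi> v = t} = card (\<phi> ` {v \<in> U s. \<phi> v = t})"
      using \<phi> by (intro card_image[symmetric]) (auto simp: bij_betw_def inj_on_def)
    also have "\<dots> \<le> card ({..<k} \<inter> {t})"
      using bij_betwE[OF \<phi>] by (intro card_mono) auto
    finally have "card {v \<in> V. a v = t} \<le> card ({..<k} - {t}) + card ({..<k} \<inter> {t})"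
      using cU[OF that] by simp
    also have "\<dots> = k" by (subst card_Un_disjoint[symmetric]) (auto simp: Un_Diff_Int)
    finally show ?thesis .
  qed
  have "coarsens V (kill_label l a0 T R) a"
    unfolding coarsens_def using a0 \<open>s \<notin> R\<close>
    by (auto simp: kill_label_eq_iff a_def)
  then have "packing l (real k) V (kill_label l a0 T R) a"
    using range load by (simp add: packing_def)
  moreover have "moved V a0 a \<le> card (T \<union> {v \<in> V. a0 v = s})"
    unfolding moved_def by (rule card_mono) (use fin in \<open>auto simp: a_def\<close>)
  then have "moved V a0 a \<le> 2 * k"
    using card_Un_le[of T "{v \<in> V. a0 v = s}"] cT init \<open>s < l\<close>
    by (simp add: initial_assignment_def)
  ultimately show ?thesis by blast
qed

text \<open>The transversal and the \<open>l\<close> groups are \<open>l + 1\<close> sets of size almost \<open>k\<close>, of which no two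
  fit on the same server. By the pigeonhole principle one group is scattered; it
  cannot be one of those already joined.\<close>

lemma kill_cost:
  assumes init: "initial_assignment l k V a0" and T: "T \<subseteq> V" "bij_betw a0 T {..<k}"
    and R: "R \<subseteq> {..<l}" and \<epsilon>: "0 < \<epsilon>" "\<epsilon> < 1" and k: "8 / (1 - \<epsilon>) \<le> real k"
    and a: "packing l ((1 + \<epsilon>) * real k) V (kill_label l a0 T R) a"
  shows "\<exists>j\<in>{..<l} - R. \<forall>b. coarsens V (kill_label l a0 T (insert j R)) b \<longrightarrow>
           (1 - \<epsilon>) / 8 * real k \<le> real (moved V a b)"
proof (rule ccontr)
  assume neg: "\<not> ?thesis"
  have fin: "finite V" "finite T" and a0: "\<And>v. v \<in> V \<Longrightarrow> a0 v < l"
    using init finite_subset[OF T(1)] by (auto simp: initial_assignment_def)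
  have cT: "card T = k" using bij_betw_same_card[OF T(2)] by simp
  \<comment> \<open>The threshold for being almost gathered, \<open>(1 - \<epsilon>) / 4 * k\<close>
    below \<open>k\<close>. Two disjoint sets of this size overflow a server. A group that loses one
    vertex to \<open>T\<close> and fewer than \<open>(1 - \<epsilon>) / 8 * k\<close> to a cheap
    move still reaches it, since \<open>k\<close> is large enough to absorb the one vertex.\<close>
  define \<theta> where "\<theta> = (3 + \<epsilon>) / 4 * real k"
  have k8: "8 \<le> (1 - \<epsilon>) * real k" using k \<epsilon> by (simp add: field_simps)
  have \<theta>1: "\<theta> \<le> real k - 1 - (1 - \<epsilon>) / 8 * real k" using k8 by (simp add: \<theta>_def field_simps)
  have \<theta>2: "(1 + \<epsilon>) * real k < 2 * \<theta>" using k8 by (simp add: \<theta>_def field_simps)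
  have \<theta>3: "\<theta> \<le> real k - 1" using \<theta>1 k8 by simp
  have k1: "1 < k" using k8 mult_right_mono[of "1 - \<epsilon>" 1 "real k"] \<epsilon>(1) by simp
  define U where "U t = {v \<in> V - T. a0 v = t}" for t
  have finU: "finite (U t)" for t using fin by (simp add: U_def)
  have cU: "real k - 1 \<le> real (card (U t))" if "t < l" for t
  proof -
    have "k - 1 \<le> card ({..<k} - {t})" by (cases "t < k") auto
    then show ?thesis using card_group_minus_transversal[OF init T that] by (simp add: U_def)
  qed
  \<comment> \<open>Every group is almost gathered on some server: those in \<open>R\<close> because
    they are joined already, the others because by \<open>neg\<close> few moves would join
    them.\<close>
  have "\<exists>x<l. \<theta> \<le> real (card {v \<in> U j. a v = x})" if "j < l" for j
  proof (cases "j \<in> R")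
    case True
    have "U j \<noteq> {}" using cU[OF that] k1 by auto
    then obtain w where w: "w \<in> U j" by auto
    have "a v = a w" if "v \<in> U j" for v
      using a w that True by (auto simp: packing_def coarsens_def U_def kill_label_def)
    then have "{v \<in> U j. a v = a w} = U j" by auto
    moreover have "a w < l" using a w by (auto simp: packing_def U_def)
    ultimately show ?thesis using cU[OF \<open>j < l\<close>] \<theta>3 by (intro exI[of _ "a w"]) auto
  next
    case False
    then obtain b where b: "coarsens V (kill_label l a0 T (insert j R)) b"
      and less: "real (moved V a b) < (1 - \<epsilon>) / 8 * real k"
      using neg \<open>j < l\<close> by (metis DiffI lessThan_iff not_le)
    have "U j \<noteq> {}" using cU[OF that] k1 by auto
    then obtain w where w: "w \<in> U j" by auto
    have bw: "b v = b w" if "v \<in> U j" for v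
      using b w that by (auto simp: coarsens_def U_def kill_label_def)
    have "U j - {v \<in> U j. a v = b w} \<subseteq> {v \<in> V. a v \<noteq> b v}"
      using bw by (auto simp: U_def)
    then have "card (U j - {v \<in> U j. a v = b w}) \<le> moved V a b"
      unfolding moved_def using fin by (intro card_mono) auto
    moreover have "card (U j - {v \<in> U j. a v = b w}) = card (U j) - card {v \<in> U j. a v = b w}"
      using finU by (intro card_Diff_subset) auto
    ultimately have *: "\<theta> < real (card {v \<in> U j. a v = b w})"
      using less cU[OF that] \<theta>1 by linarith
    \<comment> \<open>\<open>b\<close> is only known to be a coarsening, so \<open>b w < l\<close>
      has to come from \<open>a\<close>, which puts some vertex of the group on
      \<open>b w\<close>.\<close>
    moreover have "0 \<le> \<theta>" using \<epsilon>(1) by (simp add: \<theta>_def)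
    ultimately have "{v \<in> U j. a v = b w} \<noteq> {}" by (metis card.empty of_nat_0 not_less)
    then have "b w < l" using a by (auto simp: packing_def U_def)
    then show ?thesis using * by (intro exI[of _ "b w"]) auto
  qed
  then obtain m where m: "\<And>j. j < l \<Longrightarrow> m j < l"
    "\<And>j. j < l \<Longrightarrow> \<theta> \<le> real (card {v \<in> U j. a v = m j})" by metis
  have two: False if "A \<subseteq> V" "B \<subseteq> V" "A \<inter> B = {}" "x < l" "\<And>v. v \<in> A \<union> B \<Longrightarrow> a v = x"
    "\<theta> \<le> real (card A)" "\<theta> \<le> real (card B)" for A B x
  proof -
    have "finite A" "finite B" using that fin finite_subset by auto
    then have "real (card A) + real (card B) = real (card (A \<union> B))"
      using that(3) by (simp add: card_Un_disjoint)
    also have "\<dots> \<le> real (card {v \<in> V. a v = x})"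
      using fin that by (intro of_nat_mono card_mono) auto
    also have "\<dots> \<le> (1 + \<epsilon>) * real k" using a \<open>x < l\<close> by (simp add: packing_def)
    finally show False using that \<theta>2 by simp
  qed
  have "inj_on m {..<l}"
  proof (rule inj_onI, rule ccontr)
    fix i j assume "i \<in> {..<l}" "j \<in> {..<l}" "m i = m j" "i \<noteq> j"
    then show False
      by (intro two[of "{v \<in> U i. a v = m i}" "{v \<in> U j. a v = m j}" "m i"] m)
         (auto simp: U_def)
  qed
  \<comment> \<open>An injective self-map of a finite set is onto, so the server that holds all of
    \<open>T\<close> also holds at least \<theta> vertices of some group.\<close>
  then have surj: "m ` {..<l} = {..<l}" using m(1) by (intro endo_inj_surj) auto
  have "T \<noteq> {}" using cT k1 by auto
  then obtain w where w: "w \<in> T" by auto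
  have aT: "a v = a w" if "v \<in> T" for v
  proof -
    have "kill_label l a0 T R v = kill_label l a0 T R w"
      using that w by (simp add: kill_label_def)
    then show ?thesis using a that w T(1) unfolding packing_def coarsens_def by blast
  qed
  have "a w \<in> {..<l}" using a w T(1) by (auto simp: packing_def)
  then obtain j where "j < l" "a w = m j" using surj by (metis imageE lessThan_iff)
  then show False
    using T(1) aT cT \<theta>3 m(1)
    by (intro two[of T "{v \<in> U j. a v = m j}" "a w"] m(2)) (auto simp: U_def)
qed

section \<open>Joining the groups one after the other\<close>

lemma transversal_exists:
  assumes "initial_assignment l k V a0" "k \<le> l"
  obtains T where "T \<subseteq> V" "bij_betw a0 T {..<k}"
proof -
  have "\<exists>v\<in>V. a0 v = t" if "t < k" for t
  proof -
    have "card {v \<in> V. a0 v = t} = k" using assms that by (simp add: initial_assignment_def)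
    then have "{v \<in> V. a0 v = t} \<noteq> {}" using that by (metis card.empty not_less0)
    then show ?thesis by auto
  qed
  then have "{..<k} \<subseteq> a0 ` V" by auto
  then show ?thesis using that by (metis subset_image_inj inj_on_imp_bij_betw)
qed

text \<open>With \<open>l - n\<close> groups left, at least one of them is expensive to join next,
  which gives \<open>(1 - \<epsilon>) / 8 / (l - n)\<close> on average; these terms add up to a
  difference of harmonic numbers. \<open>n < l\<close> keeps one group unjoined for the optimum to
  spread.\<close>

lemma kill_adversary:
  assumes init: "initial_assignment l k V a0" and alg: "randomized_online_algorithm l k \<epsilon> V a0 M"
    and T: "T \<subseteq> V" "bij_betw a0 T {..<k}" and "k \<le> l" "0 < \<epsilon>" "\<epsilon> < 1" "8 / (1 - \<epsilon>) \<le> real k" "n < l"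
  shows "\<exists>R \<sigma>. R \<subseteq> {..<l} \<and> card R = n \<and> reveals V (kill_label l a0 T R) \<sigma> \<and>
           ennreal ((1 - \<epsilon>) / 8 * (harm l - harm (l - n))) \<le> expected_cost k V M \<sigma>"
  using \<open>n < l\<close>
proof (induction n)
  case 0
  have "finite V" using init by (simp add: initial_assignment_def)
  then obtain \<sigma> where "reveals V (kill_label l a0 T {}) \<sigma>"
    using finite_distinct_list[OF finite_clique_edges] unfolding reveals_def by metis
  then show ?case by (intro exI[of _ "{}"] exI[of _ \<sigma>]) simp
next
  case (Suc n)
  then obtain R \<sigma> where R: "R \<subseteq> {..<l}" "card R = n" and rev: "reveals V (kill_label l a0 T R) \<sigma>"
    and IH: "ennreal ((1 - \<epsilon>) / 8 * (harm l - harm (l - n))) \<le> expected_cost k V M \<sigma>" by force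
  let ?J = "{..<l} - R"
  have finR: "finite R" using R(1) finite_subset by blast
  have cJ: "card ?J = l - n" using R finR by (simp add: card_Diff_subset)
  have k0: "0 < real k" using less_le_trans[OF _ \<open>8 / (1 - \<epsilon>) \<le> real k\<close>, of 0] \<open>\<epsilon> < 1\<close> by simp
  have a0: "\<And>v. v \<in> V \<Longrightarrow> a0 v < l" using init by (auto simp: initial_assignment_def)
  have "\<exists>j\<in>?J. \<exists>\<tau>. reveals V (kill_label l a0 T (insert j R)) \<tau> \<and> expected_cost k V M \<sigma>
      + ennreal (((1 - \<epsilon>) / 8 * real k) / (real (card ?J) * real k)) \<le> expected_cost k V M \<tau>"
  proof (rule adversary_step[OF init alg rev])
    show "finite ?J" by simp
    show "?J \<noteq> {}" using cJ Suc.prems by force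
    show "coarsens V (kill_label l a0 T R) (kill_label l a0 T (insert j R))" for j
      using a0 by (auto simp: coarsens_def kill_label_eq_iff)
    show "\<exists>a. packing l (real k) V (kill_label l a0 T (insert j R)) a" if "j \<in> ?J" for j
    proof -
      have "card (insert j R) < card {..<l}"
        using that finR R(2) Suc.prems by simp
      then obtain s where "s < l" "s \<notin> insert j R"
        by (metis card_mono finR finite_insert leD lessThan_iff subsetI)
      then show ?thesis
        using kill_label_packing[OF init T \<open>k \<le> l\<close>, of "insert j R" s] that R(1) by auto
    qed
    show "0 \<le> (1 - \<epsilon>) / 8 * real k" using \<open>\<epsilon> < 1\<close> by simp
    fix a b
    assume a: "packing l ((1 + \<epsilon>) * real k) V (kill_label l a0 T R) a"
      and b: "\<And>j. j \<in> ?J \<Longrightarrow> packing l ((1 + \<epsilon>) * real k) V (kill_label l a0 T (insert j R)) (b j)"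
    obtain j where j: "j \<in> ?J" and jb: "(1 - \<epsilon>) / 8 * real k \<le> real (moved V a (b j))"
      using kill_cost[OF init T R(1) \<open>0 < \<epsilon>\<close> \<open>\<epsilon> < 1\<close> \<open>8 / (1 - \<epsilon>) \<le> real k\<close> a] b
      unfolding packing_def by meson
    note jb
    also have "\<dots> \<le> (\<Sum>j\<in>?J. real (moved V a (b j)))"
      using j by (intro member_le_sum) auto
    finally show "(1 - \<epsilon>) / 8 * real k \<le> (\<Sum>j\<in>?J. real (moved V a (b j)))" .
  qed
  then obtain j \<tau> where j: "j \<in> ?J" and rev': "reveals V (kill_label l a0 T (insert j R)) \<tau>"
    and gain: "expected_cost k V M \<sigma> + ennreal (((1 - \<epsilon>) / 8 * real k) / (real (l - n) * real k))
      \<le> expected_cost k V M \<tau>" using cJ by auto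
  have harm: "harm (l - n) = harm (l - Suc n) + inverse (real (l - n))"
    using Suc.prems harm_Suc[of "l - Suc n"] by (simp add: Suc_diff_Suc)
  have "((1 - \<epsilon>) / 8 * real k) / (real (l - n) * real k) = (1 - \<epsilon>) / 8 / real (l - n)"
    using k0 by (intro nonzero_mult_divide_mult_cancel_right) simp
  also have "\<dots> = (1 - \<epsilon>) / 8 * inverse (real (l - n))" by (rule divide_inverse)
  finally have gain_eq: "((1 - \<epsilon>) / 8 * real k) / (real (l - n) * real k)
      = (1 - \<epsilon>) / 8 * inverse (real (l - n))" .
  have "x * (h - c) = x * (h - (c + i)) + x * i" for x h c i :: real
    by (simp add: algebra_simps)
  then have "(1 - \<epsilon>) / 8 * (harm l - harm (l - Suc n)) = (1 - \<epsilon>) / 8 * (harm l - harm (l - n))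
      + ((1 - \<epsilon>) / 8 * real k) / (real (l - n) * real k)"
    unfolding harm gain_eq .
  moreover have "harm (l - n) \<le> (harm l :: real)" by (rule harm_mono) simp
  ultimately have "ennreal ((1 - \<epsilon>) / 8 * (harm l - harm (l - Suc n))) =
      ennreal ((1 - \<epsilon>) / 8 * (harm l - harm (l - n)))
      + ennreal (((1 - \<epsilon>) / 8 * real k) / (real (l - n) * real k))"
    using \<open>\<epsilon> < 1\<close> by (simp del: ennreal_plus add: ennreal_plus[symmetric])
  also have "\<dots> \<le> expected_cost k V M \<tau>"
    using gain add_right_mono[OF IH] order_trans by blast
  finally show ?case
    using rev' j R finR by (intro exI[of _ "insert j R"] exI[of _ \<tau>]) auto
qed

lemma competitive_ratio_ge_ln_servers:
  assumes init: "initial_assignment l k V a0" and alg: "randomized_online_algorithm l k \<epsilon> V a0 M"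
    and "k \<le> l" "0 < \<epsilon>" "\<epsilon> < 1" and k: "8 / (1 - \<epsilon>) \<le> real k"
  shows "ennreal ((1 - \<epsilon>) / 32 * ln (real l)) \<le> competitive_ratio l k V a0 M"
proof -
  have "8 \<le> 8 / (1 - \<epsilon>)" using \<open>0 < \<epsilon>\<close> \<open>\<epsilon> < 1\<close> by (simp add: field_simps)
  then have l8: "8 \<le> real l" and k0: "0 < real k" using k \<open>k \<le> l\<close> by linarith+
  obtain T where T: "T \<subseteq> V" "bij_betw a0 T {..<k}"
    using transversal_exists[OF init \<open>k \<le> l\<close>] .
  have lt: "l - 1 < l" using l8 by simp
  obtain R \<sigma> where R: "R \<subseteq> {..<l}" "card R = l - 1" and rev: "reveals V (kill_label l a0 T R) \<sigma>"
    and "ennreal ((1 - \<epsilon>) / 8 * (harm l - harm (l - (l - 1)))) \<le> expected_cost k V M \<sigma>"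
    using kill_adversary[OF init alg T \<open>k \<le> l\<close> \<open>0 < \<epsilon>\<close> \<open>\<epsilon> < 1\<close> k lt] by blast
  moreover have "l - (l - 1) = 1" using l8 by simp
  ultimately have onl: "ennreal ((1 - \<epsilon>) / 8 * (harm l - 1)) \<le> expected_cost k V M \<sigma>"
    by (simp add: harm_def)
  have "card R < card {..<l}" using R(2) lt by simp
  then obtain s where "s < l" "s \<notin> R"
    by (metis R(1) lessThan_iff nless_le psubsetE subsetI subset_antisym)
  then obtain a where a: "packing l (real k) V (kill_label l a0 T R) a" "moved V a0 a \<le> 2 * k"
    using kill_label_packing[OF init T \<open>k \<le> l\<close> R(1)] by blast
  \<comment> \<open>\<open>l \<ge> 8\<close> exceeds the square of e, hence
    \<open>ln l \<ge> 2\<close>, and subtracting 1 from \<open>harm l\<close> loses at most half of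
    \<open>ln l\<close>.\<close>
  have "exp 2 = exp 1 * exp (1::real)" by (simp flip: exp_add)
  also have "\<dots> \<le> (272 / 100) * (272 / 100)"
    using e_less_272 by (intro mult_mono) auto
  also have "\<dots> \<le> real l" using l8 by simp
  finally have "2 \<le> ln (real l)" using l8 by (subst ln_ge_iff) auto
  moreover have "ln (real l) \<le> ln (real l + 1)" using l8 by simp
  ultimately have "ln (real l) / 2 \<le> harm l - 1" using ln_le_harm[of l] by linarith
  then have "(1 - \<epsilon>) / 8 * (ln (real l) / 2) \<le> (1 - \<epsilon>) / 8 * (harm l - 1)"
    using \<open>\<epsilon> < 1\<close> by (intro mult_left_mono) auto
  \<comment> \<open>The factor 2 is split off as the bound on the optimum: \<open>2 * k\<close>
    moves at cost \<open>1 / k\<close> each.\<close>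
  then have "ennreal ((1 - \<epsilon>) / 32 * ln (real l) * 2) \<le> ennreal ((1 - \<epsilon>) / 8 * (harm l - 1))"
    by (intro ennreal_leI) simp
  then have "ennreal ((1 - \<epsilon>) / 32 * ln (real l) * 2) \<le> expected_cost k V M \<sigma>"
    using onl by (rule order_trans)
  then show ?thesis
    using a(2) k0 by (intro competitive_ratio_ge[OF init rev a(1), of 2]) (auto simp: field_simps)
qed

section \<open>Lower bound in the capacity\<close>

lemma bij_betw_shift:
  fixes m j :: nat
  assumes "0 < m"
  shows "bij_betw (\<lambda>y. (y + j) mod m) {..<m} {..<m}"
proof -
  have "{..<m} \<subseteq> (\<lambda>y. (y + j) mod m) ` {..<m}"
  proof
    fix c assume c: "c \<in> {..<m}"
    have "j mod m \<le> m" using assms by (simp add: less_imp_le)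
    \<comment> \<open>The preimage of \<open>c\<close> is \<open>c - j\<close> modulo
      \<open>m\<close>, written without a negative difference.\<close>
    have "((c + (m - j mod m)) mod m + j) mod m = (c + (m - j mod m) + j mod m) mod m"
      by (simp add: mod_simps)
    also have "c + (m - j mod m) + j mod m = c + m" using \<open>j mod m \<le> m\<close> by simp
    also have "(c + m) mod m = c" using c by simp
    finally show "c \<in> (\<lambda>y. (y + j) mod m) ` {..<m}"
      using assms by (intro image_eqI[of _ _ "(c + (m - j mod m)) mod m"]) auto
  qed
  then have "(\<lambda>y. (y + j) mod m) ` {..<m} = {..<m}" using assms by auto
  moreover from this have "inj_on (\<lambda>y. (y + j) mod m) {..<m}" by (intro eq_card_imp_inj_on) auto
  ultimately show ?thesis by (simp add: bij_betw_def)
qed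

text \<open>AM-GM bounds the number \<open>X t * Y t\<close> of pairs at a value \<open>t\<close> by \<open>(X t + Y t)\<^sup>2 / 4\<close>.\<close>

lemma card_crossing_pairs_ge:
  fixes A :: "nat \<Rightarrow> nat"
  assumes A: "\<And>c. c < 2 * m \<Longrightarrow> A c < l"
    and K: "\<And>t. t < l \<Longrightarrow> real (card {c \<in> {..<2 * m}. A c = t}) \<le> K"
  shows "(real m)\<^sup>2 - K * real m / 2 \<le> (\<Sum>y<m. \<Sum>x<m. of_bool (A x \<noteq> A (m + y)))"
proof -
  define X where "X t = (\<Sum>x<m. of_bool (A x = t) :: real)" for t
  define Y where "Y t = (\<Sum>y<m. of_bool (A (m + y) = t) :: real)" for t
  have XY: "X t + Y t = real (card {c \<in> {..<2 * m}. A c = t})" for t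
  proof -
    have "Y t = (\<Sum>c\<in>{m..<2 * m}. of_bool (A c = t))"
      unfolding Y_def by (rule sum.reindex_bij_witness[of _ "\<lambda>c. c - m" "\<lambda>y. m + y"]) auto
    then have "X t + Y t = (\<Sum>c<2 * m. of_bool (A c = t))"
      unfolding X_def lessThan_atLeast0 by (simp only:) (rule sum.atLeastLessThan_concat, auto)
    also have "\<dots> = real (card {c \<in> {..<2 * m}. A c = t})"
      by (simp add: sum.If_cases of_bool_def Int_def)
    finally show ?thesis .
  qed
  have total: "(\<Sum>t<l. X t) = real m" "(\<Sum>t<l. Y t) = real m"
  proof -
    have "(\<Sum>t<l. X t) = (\<Sum>x<m. \<Sum>t<l. of_bool (A x = t))"
      unfolding X_def by (rule sum.swap)
    also have "\<dots> = (\<Sum>x<m. 1)"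
      using A by (intro sum.cong refl) (simp add: of_bool_def)
    finally show "(\<Sum>t<l. X t) = real m" by simp
    have "(\<Sum>t<l. Y t) = (\<Sum>x<m. \<Sum>t<l. of_bool (A (m + x) = t))"
      unfolding Y_def by (rule sum.swap)
    also have "\<dots> = (\<Sum>x<m. 1)"
      using A by (intro sum.cong refl) (simp add: of_bool_def)
    finally show "(\<Sum>t<l. Y t) = real m" by simp
  qed
  \<comment> \<open>Pairs with equal values are counted by their common value
    \<open>t\<close>.\<close>
  have "(\<Sum>y<m. \<Sum>x<m. of_bool (A x = A (m + y)) :: real)
      = (\<Sum>y<m. \<Sum>x<m. \<Sum>t<l. of_bool (A (m + y) = t) * of_bool (A x = t))"
  proof (intro sum.cong refl)
    fix x y assume "x \<in> {..<m}" "y \<in> {..<m}"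
    have "(\<Sum>t<l. of_bool (A (m + y) = t) * of_bool (A x = t))
        = (\<Sum>t<l. if A (m + y) = t then of_bool (A x = A (m + y)) else (0::real))"
      by (intro sum.cong) auto
    also have "\<dots> = of_bool (A x = A (m + y))" using A \<open>y \<in> _\<close> by simp
    finally show "of_bool (A x = A (m + y))
        = (\<Sum>t<l. of_bool (A (m + y) = t) * of_bool (A x = t) :: real)" by simp
  qed
  also have "\<dots> = (\<Sum>y<m. \<Sum>t<l. \<Sum>x<m. of_bool (A (m + y) = t) * of_bool (A x = t))"
    by (intro sum.cong refl sum.swap)
  also have "\<dots> = (\<Sum>t<l. \<Sum>y<m. \<Sum>x<m. of_bool (A (m + y) = t) * of_bool (A x = t))"
    by (rule sum.swap)
  also have "\<dots> = (\<Sum>t<l. Y t * X t)"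
    unfolding X_def Y_def sum_product ..
  also have "\<dots> \<le> (\<Sum>t<l. K * (X t + Y t) / 4)"
  proof (rule sum_mono)
    fix t assume "t \<in> {..<l}"
    have "4 * (Y t * X t) \<le> (X t + Y t) * (X t + Y t)"
      using zero_le_square[of "X t - Y t"] by (simp add: algebra_simps)
    also have "\<dots> \<le> K * (X t + Y t)"
      using K[of t] \<open>t \<in> _\<close> by (intro mult_right_mono) (auto simp: XY)
    finally show "Y t * X t \<le> K * (X t + Y t) / 4" by simp
  qed
  also have "\<dots> = K * real m / 2"
    by (simp add: sum.distrib total flip: sum_divide_distrib sum_distrib_left)
  finally have "(\<Sum>y<m. \<Sum>x<m. of_bool (A x = A (m + y)) :: real) \<le> K * real m / 2" .
  moreover have "(\<Sum>y<m. \<Sum>x<m. of_bool (A x \<noteq> A (m + y)) :: real)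
      = (real m)\<^sup>2 - (\<Sum>y<m. \<Sum>x<m. of_bool (A x = A (m + y)))"
    by (simp add: of_bool_not_iff sum_subtractf power2_eq_square)
  ultimately show ?thesis by simp
qed

section \<open>Rounds of pairwise merging\<close>

text \<open>Per server there are \<open>p\<close> components of size \<open>s\<close> and up to
  \<open>z\<close> leftover single vertices, which are never merged and absorb the remainder when
  \<open>k\<close> is not a multiple of the component size.\<close>

definition blocks :: "nat \<Rightarrow> nat set \<Rightarrow> nat \<Rightarrow> nat \<Rightarrow> nat \<Rightarrow> (nat \<Rightarrow> nat) \<Rightarrow> bool" where
  "blocks l V p s z g \<longleftrightarrow> g ` V \<subseteq> {..<l * (p + z)} \<and>
     (\<forall>c<l * p. card {v \<in> V. g v = c} = s) \<and> (\<forall>c\<ge>l * p. card {v \<in> V. g v = c} \<le> 1)"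

text \<open>Component \<open>m + y\<close> joins the lower component \<open>(y + j) mod m\<close>.
  Leftover labels move down by \<open>m\<close>, so that the labels again have the form required by
  \<open>blocks\<close>.\<close>

definition merge_label :: "nat \<Rightarrow> nat \<Rightarrow> (nat \<Rightarrow> nat) \<Rightarrow> nat \<Rightarrow> nat" where
  "merge_label m j g v =
     (if g v < m then g v else if g v < 2 * m then (g v - m + j) mod m else g v - m)"

text \<open>Labels are dealt to the servers in turn, so each server gets \<open>p\<close> component
  labels and \<open>z\<close> leftover labels.\<close>

lemma blocks_packing:
  assumes "blocks l V p s z g" "finite V" "0 < l" "p * s + z = k"
  shows "packing l (real k) V g (\<lambda>v. g v mod l)"
proof -
  have "card {v \<in> V. g v mod l = t} \<le> k" if "t < l" for t
  proof -
    let ?C = "\<lambda>i. {v \<in> V. g v = l * i + t}"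
    have "{v \<in> V. g v mod l = t} \<subseteq> (\<Union>i<p + z. ?C i)"
    proof
      fix v assume v: "v \<in> {v \<in> V. g v mod l = t}"
      then have "g v < (p + z) * l" using assms(1) by (auto simp: blocks_def mult.commute)
      then have "g v div l < p + z" by (rule less_mult_imp_div_less)
      moreover have "g v = l * (g v div l) + t" using v by auto
      ultimately show "v \<in> (\<Union>i<p + z. ?C i)" using v by blast
    qed
    then have "card {v \<in> V. g v mod l = t} \<le> card (\<Union>i<p + z. ?C i)"
      using assms(2) by (intro card_mono) auto
    also have "\<dots> \<le> (\<Sum>i<p + z. card (?C i))" by (rule card_UN_le) simp
    also have "\<dots> \<le> (\<Sum>i<p + z. if i < p then s else 1)"
    proof (rule sum_mono)
      fix i
      show "card (?C i) \<le> (if i < p then s else 1)"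
      proof (cases "i < p")
        case True
        then have "l * Suc i \<le> l * p" by (intro mult_le_mono) auto
        then have "l * i + t < l * p" using that by simp
        then show ?thesis using assms(1) True by (simp add: blocks_def)
      next
        case False
        then have "l * p \<le> l * i + t" by (simp add: trans_le_add1)
        then show ?thesis using assms(1) False by (simp add: blocks_def)
      qed
    qed
    also have "\<dots> = (\<Sum>i<p. s) + (\<Sum>i\<in>{p..<p + z}. 1)"
    proof -
      have "{..<p + z} = {..<p} \<union> {p..<p + z}" by auto
      then show ?thesis by (simp add: sum.union_disjoint ivl_disj_int)
    qed
    also have "\<dots> = k" using assms(4) by simp
    finally show ?thesis .
  qed
  then show ?thesis using \<open>0 < l\<close> by (auto simp: packing_def coarsens_def)
qed

lemma merge_label_coarsens: "coarsens V g (merge_label m j g)"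
  by (simp add: coarsens_def merge_label_def)

text \<open>The cyclic shift is a bijection, so every lower component receives exactly one partner
  of equal size.\<close>

lemma blocks_merge:
  assumes g: "blocks l V (2 * p) s z g" and fin: "finite V" and "0 < l" "0 < p"
  shows "blocks l V p (2 * s) z (merge_label (l * p) j g)"
proof -
  define m where "m = l * p"
  have m: "0 < m" using assms by (simp add: m_def)
  have range: "g v < 2 * m + l * z" if "v \<in> V" for v
    using g that by (auto simp: blocks_def m_def algebra_simps)
  have size: "card {v \<in> V. g v = c} = s" if "c < 2 * m" for c
    using g that by (simp add: blocks_def m_def algebra_simps)
  have rest: "card {v \<in> V. g v = c} \<le> 1" if "c \<ge> 2 * m" for c
    using g that by (simp add: blocks_def m_def algebra_simps)
  have low: "merge_label m j g v < m \<longleftrightarrow> g v < 2 * m" for v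
    using m by (auto simp: merge_label_def)
  show ?thesis
    unfolding blocks_def m_def[symmetric]
  proof (intro conjI allI impI subsetI)
    fix c assume "c \<in> merge_label m j g ` V"
    then obtain v where v: "v \<in> V" "c = merge_label m j g v" by auto
    have "c < m + l * z"
    proof (cases "g v < 2 * m")
      case True
      then show ?thesis using low[of v] v by simp
    next
      case False
      then show ?thesis using range[OF v(1)] v by (simp add: merge_label_def)
    qed
    then show "c \<in> {..<l * (p + z)}" by (simp add: m_def algebra_simps)
  next
    fix c assume "c < m"
    then have "c \<in> (\<lambda>y. (y + j) mod m) ` {..<m}"
      using bij_betw_shift[OF m, of j] by (simp add: bij_betw_def)
    then obtain y where y: "y < m" "(y + j) mod m = c" by auto
    have uniq: "y' = y" if "y' < m" "(y' + j) mod m = c" for y'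
      using bij_betw_shift[OF m, of j] that y by (auto simp: bij_betw_def inj_on_def)
    have "{v \<in> V. merge_label m j g v = c} = {v \<in> V. g v = c} \<union> {v \<in> V. g v = m + y}"
    proof (intro set_eqI iffI)
      fix v assume v: "v \<in> {v \<in> V. merge_label m j g v = c}"
      then have "g v < 2 * m" using low[of v] \<open>c < m\<close> by simp
      then show "v \<in> {v \<in> V. g v = c} \<union> {v \<in> V. g v = m + y}"
        using v uniq[of "g v - m"] by (auto simp: merge_label_def split: if_splits)
    next
      fix v assume "v \<in> {v \<in> V. g v = c} \<union> {v \<in> V. g v = m + y}"
      then show "v \<in> {v \<in> V. merge_label m j g v = c}"
        using \<open>c < m\<close> y by (elim UnE) (simp_all add: merge_label_def)
    qed
    moreover have "{v \<in> V. g v = c} \<inter> {v \<in> V. g v = m + y} = {}" using \<open>c < m\<close> by auto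
    ultimately show "card {v \<in> V. merge_label m j g v = c} = 2 * s"
      using fin size[of c] size[of "m + y"] \<open>c < m\<close> y(1) by (simp add: card_Un_disjoint)
  next
    fix c assume "m \<le> c"
    have "{v \<in> V. merge_label m j g v = c} = {v \<in> V. g v = c + m}"
    proof (intro Collect_cong conj_cong refl)
      fix v
      show "merge_label m j g v = c \<longleftrightarrow> g v = c + m"
        using low[of v] \<open>m \<le> c\<close> by (cases "g v < 2 * m") (auto simp: merge_label_def)
    qed
    then show "card {v \<in> V. merge_label m j g v = c} \<le> 1" using rest[of "c + m"] \<open>m \<le> c\<close> by simp
  qed
qed

text \<open>Over all shifts \<open>j\<close>, every pair of a lower and an upper component is merged
  exactly once, so the sum counts all pairs split between servers. Each of them forces
  \<open>s\<close> moves, and the capacity allows at most \<open>cap / s\<close> components per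
  server.\<close>

lemma merge_cost:
  assumes g: "blocks l V (2 * p) s z g" and fin: "finite V" and "0 < l" "0 < p" "0 < s"
    and a: "packing l cap V g a"
    and b: "\<And>j. j < l * p \<Longrightarrow> coarsens V (merge_label (l * p) j g) (b j)"
  shows "real s * (real (l * p))\<^sup>2 - cap * real (l * p) / 2
           \<le> (\<Sum>j<l * p. real (moved V a (b j)))"
proof -
  define m where "m = l * p"
  have m: "0 < m" using assms by (simp add: m_def)
  define C where "C c = {v \<in> V. g v = c}" for c
  have finC: "finite (C c)" for c using fin by (simp add: C_def)
  have size: "card (C c) = s" if "c < 2 * m" for c
    using g that by (simp add: blocks_def m_def C_def algebra_simps)
  define A where "A c = a (SOME v. v \<in> C c)" for c
  have some: "(SOME v. v \<in> C c) \<in> C c" if "c < 2 * m" for c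
  proof -
    have "C c \<noteq> {}" using size[OF that] \<open>0 < s\<close> by auto
    then show ?thesis by (simp add: some_in_eq)
  qed
  have A: "a v = A c" if "c < 2 * m" "v \<in> C c" for v c
    using a some[OF that(1)] that(2) by (auto simp: A_def C_def packing_def coarsens_def)
  have A_less: "A c < l" if "c < 2 * m" for c
    using a some[OF that] by (auto simp: A_def C_def packing_def)
  have load: "real (card {c \<in> {..<2 * m}. A c = t}) \<le> cap / real s" if "t < l" for t
  proof -
    have "card {c \<in> {..<2 * m}. A c = t} * s = (\<Sum>c\<in>{c \<in> {..<2 * m}. A c = t}. card (C c))"
      using size by simp
    also have "\<dots> = card (\<Union>c\<in>{c \<in> {..<2 * m}. A c = t}. C c)"
      using finC by (intro card_UN_disjoint[symmetric]) (auto simp: C_def)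
    also have "\<dots> \<le> card {v \<in> V. a v = t}"
      using fin A by (intro card_mono) (auto simp: C_def)
    finally have "real (card {c \<in> {..<2 * m}. A c = t} * s) \<le> real (card {v \<in> V. a v = t})"
      by (rule of_nat_mono)
    also have "\<dots> \<le> cap" using a that by (simp add: packing_def)
    finally show ?thesis using \<open>0 < s\<close> by (simp add: field_simps)
  qed
  have cost: "real s * (\<Sum>y<m. of_bool (A ((y + j) mod m) \<noteq> A (m + y))) \<le> real (moved V a (b j))"
    if "j < m" for j
  proof -
    define D where "D = {v \<in> V. a v \<noteq> b j v}"
    define W where "W y = C ((y + j) mod m) \<union> C (m + y)" for y
    have lt: "(y + j) mod m < m" "(y + j) mod m < 2 * m" for y
      using mod_less_divisor[OF m, of "y + j"] by auto
    have W: "merge_label m j g v = (y + j) mod m" if "v \<in> W y" "y < m" for v y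
      using that lt by (auto simp: W_def C_def merge_label_def)
    have "s * of_bool (A ((y + j) mod m) \<noteq> A (m + y)) \<le> card (D \<inter> W y)" if "y < m" for y
    proof (cases "A ((y + j) mod m) = A (m + y)")
      case False
      define x where "x = (y + j) mod m"
      have x: "x < m" "C x \<subseteq> W y" "C (m + y) \<subseteq> W y" using m by (auto simp: x_def W_def)
      obtain w where w: "w \<in> C x" using some[of x] x(1) by auto
      have "b j v = b j w" if "v \<in> W y" for v
      proof -
        have "v \<in> V" "w \<in> V" "w \<in> W y" using that w x(2) by (auto simp: W_def C_def)
        moreover from this have "merge_label m j g v = merge_label m j g w"
          using W[OF that \<open>y < m\<close>] W[OF _ \<open>y < m\<close>] by metis
        moreover have "coarsens V (merge_label m j g) (b j)" using b \<open>j < m\<close> by (simp add: m_def)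
        ultimately show ?thesis unfolding coarsens_def by blast
      qed
      \<comment> \<open>Wherever \<open>b j\<close> puts the merged pair, at least one of its two
        components was elsewhere under \<open>a\<close> and moves as a whole.\<close>
      moreover have "A x \<noteq> b j w \<or> A (m + y) \<noteq> b j w" using False by (auto simp: x_def)
      ultimately obtain c where c: "c < 2 * m" "C c \<subseteq> W y" "\<And>v. v \<in> C c \<Longrightarrow> b j v \<noteq> A c"
        using x \<open>y < m\<close> by (metis add_less_cancel_left mult_2 subsetD trans_less_add1)
      have "C c \<subseteq> D \<inter> W y"
      proof
        fix v assume v: "v \<in> C c"
        then have "a v \<noteq> b j v" using A[OF c(1) v] c(3)[OF v] by simp
        then show "v \<in> D \<inter> W y" using v c(2) by (auto simp: D_def C_def)
      qed
      then have "card (C c) \<le> card (D \<inter> W y)"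
        using finC by (intro card_mono) (auto simp: W_def)
      then show ?thesis using size[OF c(1)] False by simp
    qed simp
    then have "(\<Sum>y<m. s * of_bool (A ((y + j) mod m) \<noteq> A (m + y))) \<le> (\<Sum>y<m. card (D \<inter> W y))"
      by (intro sum_mono) auto
    \<comment> \<open>Different merged pairs are disjoint, so no move is counted twice.\<close>
    also have "\<dots> = card (\<Union>y<m. D \<inter> W y)"
    proof (rule card_UN_disjoint[symmetric])
      have "x = y" if "x < m" "y < m" "v \<in> W x" "v \<in> W y" for x y v
      proof -
        have "(x + j) mod m = (y + j) mod m" using W[of v x] W[of v y] that by metis
        then show ?thesis
          using inj_onD[OF bij_betw_imp_inj_on[OF bij_betw_shift[OF m, of j]], of x y] that
          by (metis lessThan_iff)
      qed
      then show "\<forall>x\<in>{..<m}. \<forall>y\<in>{..<m}. x \<noteq> y \<longrightarrow> (D \<inter> W x) \<inter> (D \<inter> W y) = {}"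
        by blast
    qed (use finC in \<open>auto simp: W_def\<close>)
    also have "\<dots> \<le> moved V a (b j)"
      unfolding moved_def D_def using fin by (intro card_mono) auto
    finally have "real (\<Sum>y<m. s * of_bool (A ((y + j) mod m) \<noteq> A (m + y))) \<le> real (moved V a (b j))"
      by (rule of_nat_mono)
    then show ?thesis by (simp add: mult.commute flip: sum_distrib_left)
  qed
  have "(real m)\<^sup>2 - cap / real s * real m / 2
      \<le> (\<Sum>y<m. \<Sum>x<m. of_bool (A x \<noteq> A (m + y)))"
    by (rule card_crossing_pairs_ge) (use A_less load in auto)
  \<comment> \<open>For fixed \<open>y\<close> the partner \<open>(y + j) mod m\<close> runs through
    all lower components as \<open>j\<close> varies.\<close>
  also have "\<dots> = (\<Sum>y<m. \<Sum>j<m. of_bool (A ((y + j) mod m) \<noteq> A (m + y)))"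
  proof (rule sum.cong[OF refl])
    fix y
    show "(\<Sum>x<m. of_bool (A x \<noteq> A (m + y)) :: real)
        = (\<Sum>j<m. of_bool (A ((y + j) mod m) \<noteq> A (m + y)))"
      using sum.reindex_bij_betw[OF bij_betw_shift[OF m, of y],
          of "\<lambda>x. of_bool (A x \<noteq> A (m + y)) :: real"] by (simp add: add.commute)
  qed
  also have "\<dots> = (\<Sum>j<m. \<Sum>y<m. of_bool (A ((y + j) mod m) \<noteq> A (m + y)))"
    by (rule sum.swap)
  finally have "real s * ((real m)\<^sup>2 - cap / real s * real m / 2)
      \<le> real s * (\<Sum>j<m. \<Sum>y<m. of_bool (A ((y + j) mod m) \<noteq> A (m + y)))"
    by (intro mult_left_mono) auto
  also have "\<dots> \<le> (\<Sum>j<m. real (moved V a (b j)))"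
    by (subst sum_distrib_left) (rule sum_mono, rule cost, simp)
  also have "real s * ((real m)\<^sup>2 - cap / real s * real m / 2)
      = real s * (real m)\<^sup>2 - cap * real m / 2"
    using \<open>0 < s\<close> by (simp add: right_diff_distrib)
  finally show ?thesis unfolding m_def .
qed

text \<open>The gain per round does not depend on \<open>r\<close>: sizes double while numbers
  halve, so the blocks always contain \<open>l * (k - z)\<close> vertices. The hypothesis
  \<open>cap\<close> makes this gain nonnegative.\<close>

lemma merge_adversary:
  assumes init: "initial_assignment l k V a0" and alg: "randomized_online_algorithm l k \<epsilon> V a0 M"
    and "0 < l" "0 < q" and k: "q * 2 ^ N + z = k"
    and cap: "(1 + \<epsilon>) * real k \<le> real l * (real k - real z)" and "r \<le> N"
  shows "\<exists>g \<sigma>. blocks l V (q * 2 ^ (N - r)) (2 ^ r) z g \<and> reveals V g \<sigma> \<and>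
           ennreal (real r * ((real l * (real k - real z) / real k - (1 + \<epsilon>)) / 2))
             \<le> expected_cost k V M \<sigma>"
  using \<open>r \<le> N\<close>
proof (induction r)
  case 0
  have fin: "finite V" and cV: "card V = l * k" using init by (auto simp: initial_assignment_def)
  then obtain g where g: "bij_betw g V {..<l * k}"
    using finite_same_card_bij[of V "{..<l * k}"] by auto
  have "card {v \<in> V. g v = c} = (if c < l * k then 1 else 0)" for c
  proof (cases "c < l * k")
    case True
    then obtain w where "w \<in> V" "g w = c" using g by (metis bij_betw_def imageE lessThan_iff)
    then have "{v \<in> V. g v = c} = {w}" using g by (auto simp: bij_betw_def inj_on_def)
    then show ?thesis using True by simp
  next
    case False
    then have "{v \<in> V. g v = c} = {}" using g by (auto simp: bij_betw_def)
    then show ?thesis using False by (metis card.empty)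
  qed
  moreover have "c < l * k" if "c < l * (q * 2 ^ N)" for c
    using less_le_trans[OF that mult_le_mono2, of k] k by simp
  moreover have "g ` V = {..<l * k}" using g by (simp add: bij_betw_def)
  \<comment> \<open>At the start all classes are singletons; those with labels from
    \<open>l * (q * 2 ^ N)\<close> on become the leftovers.\<close>
  ultimately have "blocks l V (q * 2 ^ (N - 0)) (2 ^ 0) z g"
    using k by (simp add: blocks_def)
  moreover obtain \<sigma> where "reveals V g \<sigma>"
    using finite_distinct_list[OF finite_clique_edges[OF fin]] unfolding reveals_def by metis
  ultimately show ?case by (intro exI[of _ g] exI[of _ \<sigma>]) simp
next
  case (Suc r)
  define G where "G = (real l * (real k - real z) / real k - (1 + \<epsilon>)) / 2"
  obtain g \<sigma> where g: "blocks l V (q * 2 ^ (N - r)) (2 ^ r) z g" and rev: "reveals V g \<sigma>"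
    and IH: "ennreal (real r * G) \<le> expected_cost k V M \<sigma>"
    using Suc by (auto simp: G_def)
  have fin: "finite V" using init by (simp add: initial_assignment_def)
  have k0: "0 < k" using k \<open>0 < q\<close> by auto
  have G: "0 \<le> G" using cap k0 by (simp add: G_def field_simps)
  define p where "p = q * 2 ^ (N - Suc r)"
  have p0: "0 < p" using \<open>0 < q\<close> by (simp add: p_def)
  have "N - r = Suc (N - Suc r)" using Suc.prems by simp
  then have p: "q * 2 ^ (N - r) = 2 * p" by (simp add: p_def)
  then have g: "blocks l V (2 * p) (2 ^ r) z g" using g by simp
  have "p * 2 ^ Suc r = q * 2 ^ (N - Suc r + Suc r)" by (simp only: p_def power_add mult.assoc)
  then have pk: "p * 2 ^ Suc r + z = k" using k Suc.prems by simp
  let ?J = "{..<l * p}"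
  define X where "X = real (2 ^ r) * (real (l * p))\<^sup>2 - (1 + \<epsilon>) * real k * real (l * p) / 2"
  have kz: "real k - real z = 2 * (real p * 2 ^ r)" using arg_cong[OF pk, of real] by simp
  have XG: "X = G * (real (card ?J) * real k)"
    using k0 by (simp add: X_def G_def kz field_simps power2_eq_square)
  have "\<exists>j\<in>?J. \<exists>\<tau>. reveals V (merge_label (l * p) j g) \<tau> \<and>
      expected_cost k V M \<sigma> + ennreal (X / (real (card ?J) * real k)) \<le> expected_cost k V M \<tau>"
  proof (rule adversary_step[OF init alg rev])
    show "?J \<noteq> {}" using \<open>0 < l\<close> p0 by (auto simp: lessThan_empty_iff)
    show "coarsens V g (merge_label (l * p) j g)" for j by (rule merge_label_coarsens)
    show "\<exists>a. packing l (real k) V (merge_label (l * p) j g) a" for j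
      using blocks_packing[OF blocks_merge[OF g fin \<open>0 < l\<close> p0] fin \<open>0 < l\<close>] pk by force
    show "0 \<le> X" unfolding XG using G by simp
    show "X \<le> (\<Sum>j\<in>?J. real (moved V a (b j)))"
      if "packing l ((1 + \<epsilon>) * real k) V g a"
        "\<And>j. j \<in> ?J \<Longrightarrow> packing l ((1 + \<epsilon>) * real k) V (merge_label (l * p) j g) (b j)" for a b
      unfolding X_def
      by (rule merge_cost[OF g fin \<open>0 < l\<close> p0 _ that(1)]) (use that(2) in \<open>auto simp: packing_def\<close>)
  qed simp
  then obtain j \<tau> where rev': "reveals V (merge_label (l * p) j g) \<tau>" and
    "expected_cost k V M \<sigma> + ennreal (X / (real (card ?J) * real k)) \<le> expected_cost k V M \<tau>"
    by blast
  moreover have "X / (real (card ?J) * real k) = G" using XG k0 \<open>0 < l\<close> p0 by simp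
  ultimately have gain: "expected_cost k V M \<sigma> + ennreal G \<le> expected_cost k V M \<tau>" by simp
  have "ennreal (real (Suc r) * G) = ennreal (real r * G) + ennreal G"
    using G by (subst ennreal_plus[symmetric]) (auto simp: algebra_simps)
  also have "\<dots> \<le> expected_cost k V M \<tau>"
    using gain add_right_mono[OF IH] order_trans by blast
  finally show ?case
    using rev' blocks_merge[OF g fin \<open>0 < l\<close> p0, of j] unfolding G_def p_def
    by (intro exI conjI) auto
qed

text \<open>Moving every vertex once costs at most \<open>l\<close>, while each of the
  \<open>N\<close> rounds gains at least \<open>l * \<eta> / 2\<close>. The term
  \<open>2 ^ N / k\<close> pays for the leftovers, fewer than \<open>2 ^ N\<close> per
  server.\<close>

lemma competitive_ratio_ge_rounds:
  assumes init: "initial_assignment l k V a0" and alg: "randomized_online_algorithm l k \<epsilon> V a0 M"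
    and "0 < l" "2 ^ N \<le> k" "0 \<le> \<eta>"
    and \<eta>: "\<eta> \<le> 1 - 2 ^ N / real k - (1 + \<epsilon>) / real l"
  shows "ennreal (real N * \<eta> / 2) \<le> competitive_ratio l k V a0 M"
proof -
  define q z where "q = k div 2 ^ N" and "z = k mod 2 ^ N"
  have k: "q * 2 ^ N + z = k" unfolding q_def z_def by (rule div_mult_mod_eq)
  have q: "0 < q" using \<open>2 ^ N \<le> k\<close> by (simp add: q_def div_greater_zero_iff)
  have k0: "0 < real k" using \<open>2 ^ N \<le> k\<close> by (metis of_nat_0_less_iff pos2 zero_less_power less_le_trans)
  have "z \<le> 2 ^ N" by (simp add: z_def less_imp_le)
  then have "real z \<le> 2 ^ N" by (metis of_nat_le_numeral_power_cancel_iff)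
  then have "real z / real k \<le> 2 ^ N / real k" by (intro divide_right_mono) auto
  then have "\<eta> \<le> 1 - real z / real k - (1 + \<epsilon>) / real l" using \<eta> by linarith
  then have "real l * \<eta> \<le> real l * (1 - real z / real k - (1 + \<epsilon>) / real l)"
    by (intro mult_left_mono) auto
  also have "\<dots> = real l * (real k - real z) / real k - (1 + \<epsilon>)"
    using k0 \<open>0 < l\<close> by (simp add: field_simps)
  finally have G: "real l * \<eta> \<le> real l * (real k - real z) / real k - (1 + \<epsilon>)" .
  moreover have "0 \<le> real l * \<eta>" using \<open>0 \<le> \<eta>\<close> by simp
  ultimately have "1 + \<epsilon> \<le> real l * (real k - real z) / real k" by linarith
  then have cap: "(1 + \<epsilon>) * real k \<le> real l * (real k - real z)"
    using k0 by (simp add: pos_le_divide_eq)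
  obtain g \<sigma> where g: "blocks l V (q * 2 ^ (N - N)) (2 ^ N) z g" and rev: "reveals V g \<sigma>"
    and onl: "ennreal (real N * ((real l * (real k - real z) / real k - (1 + \<epsilon>)) / 2))
      \<le> expected_cost k V M \<sigma>"
    using merge_adversary[OF init alg \<open>0 < l\<close> q k cap order.refl] by blast
  have fin: "finite V" and cV: "card V = l * k" using init by (auto simp: initial_assignment_def)
  have a: "packing l (real k) V g (\<lambda>v. g v mod l)"
    using blocks_packing[OF g fin \<open>0 < l\<close>] k by simp
  have "moved V a0 (\<lambda>v. g v mod l) \<le> l * k"
    unfolding moved_def cV[symmetric] using fin by (intro card_mono) auto
  then have "real (moved V a0 (\<lambda>v. g v mod l)) \<le> real (l * k)" by (rule of_nat_mono)
  then have opt: "real (moved V a0 (\<lambda>v. g v mod l)) / real k \<le> real l"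
    using k0 by (simp add: field_simps)
  have "real N * \<eta> / 2 * real l = real N * (real l * \<eta> / 2)" by simp
  also have "\<dots> \<le> real N * ((real l * (real k - real z) / real k - (1 + \<epsilon>)) / 2)"
    using G by (intro mult_left_mono) auto
  finally have "ennreal (real N * \<eta> / 2 * real l) \<le> expected_cost k V M \<sigma>"
    using onl ennreal_leI order_trans by blast
  then show ?thesis
    using \<open>0 < l\<close> by (intro competitive_ratio_ge[OF init rev a opt]) auto
qed

lemma competitive_ratio_ge_ln_capacity:
  fixes \<epsilon> :: real
  assumes "\<epsilon> > 0"
  shows "\<exists>c>0. \<exists>k0\<ge>1. \<forall>k\<ge>k0. \<forall>l V a0 M. real l > 1 + \<epsilon> \<longrightarrow> initial_assignment l k V a0 \<longrightarrow>
           randomized_online_algorithm l k \<epsilon> V a0 M \<longrightarrow>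
           ennreal (c * ln (real k)) \<le> competitive_ratio l k V a0 M"
proof -
  \<comment> \<open>The least integer above \<open>1 + \<epsilon>\<close>, so that one \<eta> serves
    all admissible \<open>l\<close>.\<close>
  define l0 where "l0 = nat \<lfloor>1 + \<epsilon>\<rfloor> + 1"
  have l0: "1 + \<epsilon> < real l0" using assms unfolding l0_def by linarith
  have l0_le: "l0 \<le> l" if "1 + \<epsilon> < real l" for l using that assms unfolding l0_def by linarith
  \<comment> \<open>Half of the slack at \<open>l0\<close>; the other half pays for
    \<open>2 ^ N / k\<close>.\<close>
  define \<eta> where "\<eta> = (1 - (1 + \<epsilon>) / real l0) / 2"
  have \<eta>: "0 < \<eta>" using l0 assms by (simp add: \<eta>_def field_simps)
  obtain n where n: "(1 / 2) ^ n < \<eta>" using real_arch_pow_inv[OF \<eta>, of "1 / 2"] by auto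
  define N0 where "N0 = Suc n"
  have N0: "(1 / 2) ^ N0 \<le> \<eta>" using n \<eta> by (simp add: N0_def)
  have "ennreal (\<eta> / 8 * ln (real k)) \<le> competitive_ratio l k V a0 M"
    if k: "4 ^ N0 \<le> k" and l: "real l > 1 + \<epsilon>" and init: "initial_assignment l k V a0"
      and alg: "randomized_online_algorithm l k \<epsilon> V a0 M" for k l V a0 M
  proof -
    have k1: "1 \<le> k" using k by (metis le_trans one_le_numeral one_le_power)
    \<comment> \<open>With base 4 the number of rounds is still of order \<open>ln k\<close>, but
      \<open>2 ^ N / k\<close> is at most \<open>(1 / 2) ^ N\<close> and becomes small.\<close>
    then obtain N where N: "4 ^ N \<le> k" "k < 4 ^ (N + 1)"
      using ex_power_ivl1[of 4 k] by auto
    have "(4::nat) ^ N0 < 4 ^ (N + 1)" using k N(2) by simp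
    then have "N0 \<le> N" using power_less_imp_less_exp[of "4::nat" N0 "N + 1"] by simp
    then have N1: "1 \<le> real N" by (simp add: N0_def)
    have "2 ^ N / real k \<le> 2 ^ N / 4 ^ N"
    proof (rule divide_left_mono)
      show "4 ^ N \<le> real k" using N(1) by (metis numeral_power_le_of_nat_cancel_iff)
    qed (use k1 in auto)
    also have "\<dots> = (1 / 2) ^ N" by (simp flip: power_divide)
    also have "\<dots> \<le> (1 / 2) ^ N0" using \<open>N0 \<le> N\<close> by (intro power_decreasing) auto
    also have "\<dots> \<le> \<eta>" by (rule N0)
    finally have A: "2 ^ N / real k \<le> \<eta>" .
    have "(1 + \<epsilon>) / real l \<le> (1 + \<epsilon>) / real l0"
      using assms l0 l0_le[OF l] by (intro divide_left_mono) auto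
    also have "\<dots> = 1 - 2 * \<eta>" using l0 assms by (simp add: \<eta>_def field_simps)
    finally have "\<eta> \<le> 1 - 2 ^ N / real k - (1 + \<epsilon>) / real l" using A by linarith
    moreover have "0 < l" using l assms by (cases l) auto
    moreover have "2 ^ N \<le> k"
      using N(1) power_mono[of "2::nat" 4 N] by simp
    ultimately have main: "ennreal (real N * \<eta> / 2) \<le> competitive_ratio l k V a0 M"
      using competitive_ratio_ge_rounds[OF init alg] \<eta> by simp
    \<comment> \<open>As \<open>N \<ge> 1\<close>, \<open>(N + 1) * ln 4\<close> is at most
      \<open>2 * N * 2\<close>. So \<open>N\<close> is at least \<open>ln k / 4\<close>, which turns
      \<open>\<eta> / 2\<close> per round into the constant \<open>\<eta> / 8\<close>.\<close>
    have "ln (real k) \<le> ln (real (4 ^ (N + 1)))"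
      using N(2) k1 by (subst ln_le_cancel_iff) (auto simp del: of_nat_power)
    also have "\<dots> = real (N + 1) * ln (4::real)"
      unfolding of_nat_power of_nat_numeral by (rule ln_realpow)
    also have "ln (4::real) = 2 * ln 2" using ln_realpow[of 2 2] by simp
    also have "real (N + 1) * (2 * ln 2) \<le> (2 * real N) * (2 * 1)"
      using N1 ln_2_less_1 by (intro mult_mono) auto
    finally have "ln (real k) \<le> 4 * real N" by simp
    then have "\<eta> / 8 * ln (real k) \<le> \<eta> / 8 * (4 * real N)" using \<eta> by (intro mult_left_mono) auto
    then have "ennreal (\<eta> / 8 * ln (real k)) \<le> ennreal (real N * \<eta> / 2)"
      by (intro ennreal_leI) (simp add: mult.commute)
    then show ?thesis using main by (rule order_trans)
  qed
  then show ?thesis using \<eta> by (intro exI[of _ "\<eta> / 8"] conjI exI[of _ "4 ^ N0"]) auto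
qed

theorem theorem7p2:
  fixes \<epsilon> :: real and D :: nat
  assumes "\<epsilon> > 0"
  shows "\<exists>c>0. \<exists>k0. \<forall>k\<ge>k0. \<forall>l. real l > 1 + \<epsilon> \<and> (\<epsilon> < 1 \<or> l \<le> k ^ D) \<longrightarrow>
           (\<forall>V a0 M. initial_assignment l k V a0 \<and> randomized_online_algorithm l k \<epsilon> V a0 M \<longrightarrow>
              ennreal (c * (ln (real l) + ln (real k))) \<le> competitive_ratio l k V a0 M)"
proof -
  obtain c1 k1 where c1: "0 < c1" and k1: "1 \<le> k1"
    and capacity: "\<And>k l V a0 M. k1 \<le> k \<Longrightarrow> real l > 1 + \<epsilon> \<Longrightarrow> initial_assignment l k V a0 \<Longrightarrow>
      randomized_online_algorithm l k \<epsilon> V a0 M \<Longrightarrow>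
      ennreal (c1 * ln (real k)) \<le> competitive_ratio l k V a0 M"
    using competitive_ratio_ge_ln_capacity[OF assms] by blast
  show ?thesis
  proof (cases "\<epsilon> < 1")
    case True
    \<comment> \<open>The sum of the two logarithms is at most twice the larger one, so each of the
      two constants is halved.\<close>
    define c where "c = min (c1 / 2) ((1 - \<epsilon>) / 64)"
    have c: "0 < c" "2 * c \<le> c1" "2 * c \<le> (1 - \<epsilon>) / 32" using c1 True by (auto simp: c_def min_def)
    have "ennreal (c * (ln (real l) + ln (real k))) \<le> competitive_ratio l k V a0 M"
      if k: "max k1 (nat \<lceil>8 / (1 - \<epsilon>)\<rceil>) \<le> k" and l: "real l > 1 + \<epsilon>"
        and init: "initial_assignment l k V a0"
        and alg: "randomized_online_algorithm l k \<epsilon> V a0 M" for k l V a0 M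
    proof -
      have k': "k1 \<le> k" "8 / (1 - \<epsilon>) \<le> real k" using k by linarith+
      have pos: "1 \<le> k" "1 \<le> l" using k1 k' l assms by linarith+
      show ?thesis
      proof (cases "k \<le> l")
        case True
        have "c * (ln (real l) + ln (real k)) \<le> c * (2 * ln (real l))"
          using True pos c(1) by (intro mult_left_mono) auto
        also have "\<dots> \<le> (1 - \<epsilon>) / 32 * ln (real l)"
          using mult_right_mono[OF c(3), of "ln (real l)"] pos by simp
        finally show ?thesis
          using competitive_ratio_ge_ln_servers[OF init alg True assms \<open>\<epsilon> < 1\<close> k'(2)]
          by (meson ennreal_leI order_trans)
      next
        case False
        have "c * (ln (real l) + ln (real k)) \<le> c * (2 * ln (real k))"
          using False pos c(1) by (intro mult_left_mono) auto
        also have "\<dots> \<le> c1 * ln (real k)"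
          using mult_right_mono[OF c(2), of "ln (real k)"] pos by simp
        finally show ?thesis
          using capacity[OF k'(1) l init alg] by (meson ennreal_leI order_trans)
      qed
    qed
    then show ?thesis using c(1) by blast
  next
    case False
    \<comment> \<open>For \<epsilon> at least 1 the capacity bound alone suffices:
      \<open>l \<le> k ^ D\<close> makes \<open>ln l\<close> at most
      \<open>D * ln k\<close>.\<close>
    have "ennreal (c1 / real (D + 1) * (ln (real l) + ln (real k))) \<le> competitive_ratio l k V a0 M"
      if k: "k1 \<le> k" and l: "real l > 1 + \<epsilon>" "l \<le> k ^ D" and init: "initial_assignment l k V a0"
        and alg: "randomized_online_algorithm l k \<epsilon> V a0 M" for k l V a0 M
    proof -
      have pos: "0 < real k" "0 < real l" using k1 k l assms by linarith+
      have "real l \<le> real k ^ D" using l(2) by (metis of_nat_le_iff of_nat_power)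
      then have "ln (real l) \<le> ln (real k ^ D)" using pos by (subst ln_le_cancel_iff) auto
      also have "\<dots> = real D * ln (real k)" using pos by (simp add: ln_realpow)
      finally have "ln (real l) + ln (real k) \<le> real (D + 1) * ln (real k)"
        by (simp add: algebra_simps)
      then have "c1 / real (D + 1) * (ln (real l) + ln (real k))
          \<le> c1 / real (D + 1) * (real (D + 1) * ln (real k))"
        using c1 by (intro mult_left_mono) auto
      also have "\<dots> = c1 * ln (real k)" by simp
      finally show ?thesis
        using capacity[OF k l(1) init alg] by (meson ennreal_leI order_trans)
    qed
    moreover have "0 < c1 / real (D + 1)" using c1 by simp
    ultimately show ?thesis using False by blast
  qed
qed

end
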